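(* Let $(M,J,g,\tilde g)$ be an almost complex manifold with Norden metric $g$ and associated Norden metric $\tilde g$. The tangent bundle $TM$ equipped with the almost hypercomplex structure $H=(J_1,J_2,J_3)$ defined by $$J_1X'=-(JX)',\ J_1X''=(JX)'';\qquad J_2X'=X'',\ J_2X''=-X';\qquad J_3X'=(JX)'',\ J_3X''=(JX)'$$ and the metric $\widehat g$ defined by $$\widehat g(X',Y')=\widehat g(X'',Y'')=0,\qquad \widehat g(X',Y'')=\widehat g(X'',Y')=g(X,Y)$$ is an almost hypercomplex manifold with Hermitian-Norden metrics.
   Context: An almost complex manifold with Norden metric $(M,J,g)$ is a $2n$-dimensional manifold with $J^2=-I$ and a pseudo-Riemannian metric $g$ with $g(Jx,Jy)=-g(x,y)$; $\tilde g(x,y)=g(Jx,y)$. For vector fields $X$ on $M$, $X'$ and $X''$ denote the horizontal and vertical lifts to $TM$, the horizontal lift being taken with respect to the Levi-Civita connection of $g$. ($\widehat g$ is the complete lift of $g$.) An almost hypercomplex manifold with Hermitian-Norden metrics is a $4n$-dimensional manifold with almost complex structures $J_1,J_2,J_3$ such that $J_\alpha=J_\beta\circ J_\gamma=-J_\gamma\circ J_\beta$, $J_\alpha^2=-I$ for all cyclic permutations $(\alpha,\beta,\gamma)$ of $(1,2,3)$, and a pseudo-Riemannian metric $\widehat g$ of neutral signature with $\widehat g(J_\alpha\cdot,J_\alpha\cdot)=\varepsilon_\alpha\widehat g(\cdot,\cdot)$, $\varepsilon_1=1$, $\varepsilon_2=\varepsilon_3=-1$ (together with the associated tensors $\widehat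 g_\alpha(\cdot,\cdot)=\widehat g(J_\alpha\cdot,\cdot)$). *)

theory Defs
  imports "HOL-Analysis.Analysis" "HOL-Library.Function_Algebras"
begin

section \<open>Functions into a real vector space\<close>

instantiation "fun" :: (type, real_vector) real_vector
begin

definition scaleR_fun :: "real \<Rightarrow> ('a \<Rightarrow> 'b) \<Rightarrow> 'a \<Rightarrow> 'b"
  where "scaleR_fun r f = (\<lambda>x. r *\<^sub>R f x)"

instance
  by standard (auto simp: scaleR_fun_def fun_eq_iff scaleR_add_right scaleR_add_left)

end


section \<open>Smooth maps between open subsets of normed spaces\<close>

primrec Ck_on :: "nat \<Rightarrow> 'a::real_normed_vector set \<Rightarrow> ('a \<Rightarrow> 'b::real_normed_vector) \<Rightarrow> bool"
  where
    "Ck_on 0 S f \<longleftrightarrow> continuous_on S f"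
  | "Ck_on (Suc k) S f \<longleftrightarrow> (\<forall>x\<in>S. f differentiable (at x)) \<and>
       (\<forall>v. Ck_on k S (\<lambda>x. frechet_derivative f (at x) v))"

text \<open>Only used for open sets \<open>S\<close>.\<close>
definition smooth_on :: "'a::real_normed_vector set \<Rightarrow> ('a \<Rightarrow> 'b::real_normed_vector) \<Rightarrow> bool"
  where "smooth_on S f \<longleftrightarrow> (\<forall>k. Ck_on k S f)"


section \<open>Smooth manifolds\<close>

text \<open>
  A chart is a pair of its domain and its coordinate map; the values of the coordinate map outside
  the domain are irrelevant. A manifold is given by a smooth atlas (not necessarily maximal), its
  points being those covered by the charts and its topology being the one that makes all charts
  homeomorphisms onto open sets. The dimension of the manifold is the dimension \<open>DIM('e)\<close> of the
  model space.
\<close>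
type_synonym ('a, 'e) chart = "'a set \<times> ('a \<Rightarrow> 'e)"

abbreviation cdom :: "('a, 'e) chart \<Rightarrow> 'a set" where "cdom \<equiv> fst"
abbreviation cmap :: "('a, 'e) chart \<Rightarrow> 'a \<Rightarrow> 'e" where "cmap \<equiv> snd"

definition cinv :: "('a, 'e) chart \<Rightarrow> 'e \<Rightarrow> 'a"
  where "cinv c = inv_into (cdom c) (cmap c)"

definition carrier :: "('a, 'e) chart set \<Rightarrow> 'a set"
  where "carrier A = (\<Union>c\<in>A. cdom c)"

definition smooth_atlas :: "('a, 'e::euclidean_space) chart set \<Rightarrow> bool"
  where "smooth_atlas A \<longleftrightarrow>
    (\<forall>c\<in>A. inj_on (cmap c) (cdom c) \<and> open (cmap c ` cdom c)) \<and>
    (\<forall>c\<in>A. \<forall>d\<in>A. open (cmap c ` (cdom c \<inter> cdom d)) \<and>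
       smooth_on (cmap c ` (cdom c \<inter> cdom d)) (cmap d \<circ> cinv c))"

definition atlas_topology :: "('a, 'e::euclidean_space) chart set \<Rightarrow> 'a topology"
  where "atlas_topology A =
    topology (\<lambda>W. W \<subseteq> carrier A \<and> (\<forall>c\<in>A. open (cmap c ` (W \<inter> cdom c))))"

definition smooth_manifold :: "('a, 'e::euclidean_space) chart set \<Rightarrow> bool"
  where "smooth_manifold A \<longleftrightarrow>
    smooth_atlas A \<and> Hausdorff_space (atlas_topology A) \<and> second_countable (atlas_topology A)"

lemma openin_atlas_topology:
  assumes "smooth_atlas A"
  shows "openin (atlas_topology A) W \<longleftrightarrow>
    W \<subseteq> carrier A \<and> (\<forall>c\<in>A. open (cmap c ` (W \<inter> cdom c)))"
proof -
  have "istopology (\<lambda>W. W \<subseteq> carrier A \<and> (\<forall>c\<in>A. open (cmap c ` (W \<inter> cdom c))))"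
    unfolding istopology_def
  proof (intro conjI allI impI ballI)
    fix S T c
    assume S: "S \<subseteq> carrier A \<and> (\<forall>c\<in>A. open (cmap c ` (S \<inter> cdom c)))"
      and T: "T \<subseteq> carrier A \<and> (\<forall>c\<in>A. open (cmap c ` (T \<inter> cdom c)))"
    then show "S \<inter> T \<subseteq> carrier A" by auto
    assume c: "c \<in> A"
    then have "inj_on (cmap c) (cdom c)" using assms by (auto simp: smooth_atlas_def)
    then have "cmap c ` (S \<inter> T \<inter> cdom c) = cmap c ` (S \<inter> cdom c) \<inter> cmap c ` (T \<inter> cdom c)"
      by (auto simp: inj_on_def)
    then show "open (cmap c ` (S \<inter> T \<inter> cdom c))" using S T c by auto
  next
    fix \<K>
    assume K: "\<forall>K\<in>\<K>. K \<subseteq> carrier A \<and> (\<forall>c\<in>A. open (cmap c ` (K \<inter> cdom c)))"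
    then show "\<Union>\<K> \<subseteq> carrier A" by auto
    fix c assume c: "c \<in> A"
    have "cmap c ` (\<Union>\<K> \<inter> cdom c) = (\<Union>K\<in>\<K>. cmap c ` (K \<inter> cdom c))" by auto
    then show "open (cmap c ` (\<Union>\<K> \<inter> cdom c))" using K c by auto
  qed
  then show ?thesis by (simp add: atlas_topology_def)
qed


section \<open>Tangent vectors, vector fields and tensor fields\<close>

text \<open>
  A tangent vector at \<open>p\<close> is the family of its components with respect to all charts around \<open>p\<close>,
  which transform by the derivatives of the coordinate changes; the family is padded with \<open>0\<close> for
  all other charts, so that tangent vectors at \<open>p\<close> form a linear subspace of a function space.
\<close>
type_synonym ('a, 'e) tvec = "('a, 'e) chart \<Rightarrow> 'e"

definition tangent_space :: "('a, 'e::euclidean_space) chart set \<Rightarrow> 'a \<Rightarrow> ('a, 'e) tvec set"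
  where "tangent_space A p = {v.
    (\<forall>c. c \<notin> A \<or> p \<notin> cdom c \<longrightarrow> v c = 0) \<and>
    (\<forall>c\<in>A. \<forall>d\<in>A. p \<in> cdom c \<inter> cdom d \<longrightarrow>
       v d = frechet_derivative (cmap d \<circ> cinv c) (at (cmap c p)) (v c))}"

text \<open>The tangent vector at \<open>p\<close> with components \<open>\<xi>\<close> in the chart \<open>c\<close>; as a function of \<open>p\<close>, this
  is the vector field on the domain of \<open>c\<close> with constant components \<open>\<xi>\<close>.\<close>
definition coord_field ::
  "('a, 'e::euclidean_space) chart set \<Rightarrow> ('a, 'e) chart \<Rightarrow> 'e \<Rightarrow> 'a \<Rightarrow> ('a, 'e) tvec"
  where "coord_field A c \<xi> p = (\<lambda>d. if d \<in> A \<and> p \<in> cdom d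
    then frechet_derivative (cmap d \<circ> cinv c) (at (cmap c p)) \<xi> else 0)"

definition smooth_fun_on :: "('a, 'e::euclidean_space) chart set \<Rightarrow> 'a set \<Rightarrow> ('a \<Rightarrow> real) \<Rightarrow> bool"
  where "smooth_fun_on A W f \<longleftrightarrow>
    (\<forall>c\<in>A. smooth_on (cmap c ` (W \<inter> cdom c)) (f \<circ> cinv c))"

definition vector_field_on ::
  "('a, 'e::euclidean_space) chart set \<Rightarrow> 'a set \<Rightarrow> ('a \<Rightarrow> ('a, 'e) tvec) \<Rightarrow> bool"
  where "vector_field_on A W X \<longleftrightarrow>
    (\<forall>p\<in>W. X p \<in> tangent_space A p) \<and>
    (\<forall>c\<in>A. smooth_on (cmap c ` (W \<inter> cdom c)) (\<lambda>x. X (cinv c x) c))"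

text \<open>The directional derivative of a smooth function does not depend on the chosen chart.\<close>
definition dir_deriv ::
  "('a, 'e::euclidean_space) chart set \<Rightarrow> 'a \<Rightarrow> ('a, 'e) tvec \<Rightarrow> ('a \<Rightarrow> real) \<Rightarrow> real"
  where "dir_deriv A p u f = (let c = (SOME c. c \<in> A \<and> p \<in> cdom c)
    in frechet_derivative (f \<circ> cinv c) (at (cmap c p)) (u c))"

definition lie_bracket :: "('a, 'e::euclidean_space) chart set \<Rightarrow>
    ('a \<Rightarrow> ('a, 'e) tvec) \<Rightarrow> ('a \<Rightarrow> ('a, 'e) tvec) \<Rightarrow> 'a \<Rightarrow> ('a, 'e) tvec"
  where "lie_bracket A X Y p = (\<lambda>c. if c \<in> A \<and> p \<in> cdom c
    then frechet_derivative (\<lambda>x. Y (cinv c x) c) (at (cmap c p)) (X p c)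
       - frechet_derivative (\<lambda>x. X (cinv c x) c) (at (cmap c p)) (Y p c)
    else 0)"

text \<open>Tensor fields of types (1,1) and (0,2); smoothness means that their components in every
  chart are smooth.\<close>
definition tensor11 :: "('a, 'e::euclidean_space) chart set \<Rightarrow>
    ('a \<Rightarrow> ('a, 'e) tvec \<Rightarrow> ('a, 'e) tvec) \<Rightarrow> bool"
  where "tensor11 A J \<longleftrightarrow>
    (\<forall>p\<in>carrier A. \<forall>x\<in>tangent_space A p. \<forall>y\<in>tangent_space A p. \<forall>r.
       J p x \<in> tangent_space A p \<and>
       J p (x + y) = J p x + J p y \<and>
       J p (r *\<^sub>R x) = r *\<^sub>R J p x) \<and>
    (\<forall>c\<in>A. \<forall>\<xi>. smooth_on (cmap c ` cdom c)
       (\<lambda>x. J (cinv c x) (coord_field A c \<xi> (cinv c x)) c))"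

definition tensor02 :: "('a, 'e::euclidean_space) chart set \<Rightarrow>
    ('a \<Rightarrow> ('a, 'e) tvec \<Rightarrow> ('a, 'e) tvec \<Rightarrow> real) \<Rightarrow> bool"
  where "tensor02 A g \<longleftrightarrow>
    (\<forall>p\<in>carrier A. \<forall>x\<in>tangent_space A p. \<forall>y\<in>tangent_space A p. \<forall>z\<in>tangent_space A p. \<forall>r.
       g p (x + y) z = g p x z + g p y z \<and>
       g p z (x + y) = g p z x + g p z y \<and>
       g p (r *\<^sub>R x) z = r * g p x z \<and>
       g p z (r *\<^sub>R x) = r * g p z x) \<and>
    (\<forall>c\<in>A. \<forall>\<xi> \<eta>. smooth_on (cmap c ` cdom c)
       (\<lambda>x. g (cinv c x) (coord_field A c \<xi> (cinv c x)) (coord_field A c \<eta> (cinv c x))))"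


section \<open>Pseudo-Riemannian metrics and the Levi-Civita connection\<close>

definition pseudo_riemannian_metric :: "('a, 'e::euclidean_space) chart set \<Rightarrow>
    ('a \<Rightarrow> ('a, 'e) tvec \<Rightarrow> ('a, 'e) tvec \<Rightarrow> real) \<Rightarrow> bool"
  where "pseudo_riemannian_metric A g \<longleftrightarrow> tensor02 A g \<and>
    (\<forall>p\<in>carrier A. \<forall>x\<in>tangent_space A p. \<forall>y\<in>tangent_space A p. g p x y = g p y x) \<and>
    (\<forall>p\<in>carrier A. \<forall>x\<in>tangent_space A p.
       (\<forall>y\<in>tangent_space A p. g p x y = 0) \<longrightarrow> x = 0)"

text \<open>The bilinear form \<open>b\<close> on \<open>V\<close> has an orthonormal basis with \<open>r\<close> vectors of square \<open>1\<close>
  (the set \<open>P\<close>) and \<open>s\<close> vectors of square \<open>-1\<close> (the set \<open>N\<close>).\<close>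
definition has_signature :: "'v::real_vector set \<Rightarrow> ('v \<Rightarrow> 'v \<Rightarrow> real) \<Rightarrow> nat \<Rightarrow> nat \<Rightarrow> bool"
  where "has_signature V b r s \<longleftrightarrow> (\<exists>P N.
    finite P \<and> finite N \<and> P \<inter> N = {} \<and> card P = r \<and> card N = s \<and>
    independent (P \<union> N) \<and> span (P \<union> N) = V \<and>
    (\<forall>x\<in>P. b x x = 1) \<and> (\<forall>x\<in>N. b x x = -1) \<and>
    (\<forall>x\<in>P \<union> N. \<forall>y\<in>P \<union> N. x \<noteq> y \<longrightarrow> b x y = 0))"

text \<open>
  Linear connections are taken to act on vector fields over arbitrary open subsets \<open>W\<close> of the
  manifold (every connection restricts uniquely to open subsets). Vector fields being total
  functions, the dependence of \<open>nabla X Y p\<close> on the germs of \<open>X\<close> and \<open>Y\<close> only is a consequence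
  of the axioms: multiply with the function that is \<open>0\<close> on \<open>W\<close> and \<open>1\<close> elsewhere, which is
  smooth on \<open>W\<close>.
\<close>
definition linear_connection :: "('a, 'e::euclidean_space) chart set \<Rightarrow>
    (('a \<Rightarrow> ('a, 'e) tvec) \<Rightarrow> ('a \<Rightarrow> ('a, 'e) tvec) \<Rightarrow> 'a \<Rightarrow> ('a, 'e) tvec) \<Rightarrow> bool"
  where "linear_connection A nabla \<longleftrightarrow>
    (\<forall>W X Y. openin (atlas_topology A) W \<and> vector_field_on A W X \<and> vector_field_on A W Y \<longrightarrow>
       vector_field_on A W (nabla X Y) \<and>
       (\<forall>Z. vector_field_on A W Z \<longrightarrow> (\<forall>p\<in>W.
          nabla (\<lambda>q. X q + Z q) Y p = nabla X Y p + nabla Z Y p \<and>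
          nabla X (\<lambda>q. Y q + Z q) p = nabla X Y p + nabla X Z p)) \<and>
       (\<forall>f. smooth_fun_on A W f \<longrightarrow> (\<forall>p\<in>W.
          nabla (\<lambda>q. f q *\<^sub>R X q) Y p = f p *\<^sub>R nabla X Y p \<and>
          nabla X (\<lambda>q. f q *\<^sub>R Y q) p = dir_deriv A p (X p) f *\<^sub>R Y p + f p *\<^sub>R nabla X Y p)))"

definition torsion_free :: "('a, 'e::euclidean_space) chart set \<Rightarrow>
    (('a \<Rightarrow> ('a, 'e) tvec) \<Rightarrow> ('a \<Rightarrow> ('a, 'e) tvec) \<Rightarrow> 'a \<Rightarrow> ('a, 'e) tvec) \<Rightarrow> bool"
  where "torsion_free A nabla \<longleftrightarrow>
    (\<forall>W X Y. openin (atlas_topology A) W \<and> vector_field_on A W X \<and> vector_field_on A W Y \<longrightarrow>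
       (\<forall>p\<in>W. nabla X Y p - nabla Y X p = lie_bracket A X Y p))"

definition metric_connection :: "('a, 'e::euclidean_space) chart set \<Rightarrow>
    ('a \<Rightarrow> ('a, 'e) tvec \<Rightarrow> ('a, 'e) tvec \<Rightarrow> real) \<Rightarrow>
    (('a \<Rightarrow> ('a, 'e) tvec) \<Rightarrow> ('a \<Rightarrow> ('a, 'e) tvec) \<Rightarrow> 'a \<Rightarrow> ('a, 'e) tvec) \<Rightarrow> bool"
  where "metric_connection A g nabla \<longleftrightarrow>
    (\<forall>W X Y Z. openin (atlas_topology A) W \<and>
       vector_field_on A W X \<and> vector_field_on A W Y \<and> vector_field_on A W Z \<longrightarrow>
       (\<forall>p\<in>W. dir_deriv A p (X p) (\<lambda>q. g q (Y q) (Z q)) =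
          g p (nabla X Y p) (Z p) + g p (Y p) (nabla X Z p)))"

definition levi_civita_connection :: "('a, 'e::euclidean_space) chart set \<Rightarrow>
    ('a \<Rightarrow> ('a, 'e) tvec \<Rightarrow> ('a, 'e) tvec \<Rightarrow> real) \<Rightarrow>
    (('a \<Rightarrow> ('a, 'e) tvec) \<Rightarrow> ('a \<Rightarrow> ('a, 'e) tvec) \<Rightarrow> 'a \<Rightarrow> ('a, 'e) tvec) \<Rightarrow> bool"
  where "levi_civita_connection A g nabla \<longleftrightarrow>
    linear_connection A nabla \<and> torsion_free A nabla \<and> metric_connection A g nabla"


section \<open>Norden and Hermitian-Norden structures\<close>

definition almost_complex_structure :: "('a, 'e::euclidean_space) chart set \<Rightarrow>
    ('a \<Rightarrow> ('a, 'e) tvec \<Rightarrow> ('a, 'e) tvec) \<Rightarrow> bool"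
  where "almost_complex_structure A J \<longleftrightarrow> tensor11 A J \<and>
    (\<forall>p\<in>carrier A. \<forall>x\<in>tangent_space A p. J p (J p x) = - x)"

definition associated_tensor :: "('a \<Rightarrow> ('a, 'e) tvec \<Rightarrow> ('a, 'e) tvec) \<Rightarrow>
    ('a \<Rightarrow> ('a, 'e) tvec \<Rightarrow> ('a, 'e) tvec \<Rightarrow> real) \<Rightarrow>
    'a \<Rightarrow> ('a, 'e) tvec \<Rightarrow> ('a, 'e) tvec \<Rightarrow> real"
  where "associated_tensor J g p x y = g p (J p x) y"

definition almost_complex_norden_manifold :: "nat \<Rightarrow> ('a, 'e::euclidean_space) chart set \<Rightarrow>
    ('a \<Rightarrow> ('a, 'e) tvec \<Rightarrow> ('a, 'e) tvec) \<Rightarrow>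
    ('a \<Rightarrow> ('a, 'e) tvec \<Rightarrow> ('a, 'e) tvec \<Rightarrow> real) \<Rightarrow>
    ('a \<Rightarrow> ('a, 'e) tvec \<Rightarrow> ('a, 'e) tvec \<Rightarrow> real) \<Rightarrow> bool"
  where "almost_complex_norden_manifold n A J g g' \<longleftrightarrow>
    smooth_manifold A \<and> DIM('e) = 2 * n \<and>
    almost_complex_structure A J \<and> pseudo_riemannian_metric A g \<and>
    (\<forall>p\<in>carrier A. \<forall>x\<in>tangent_space A p. \<forall>y\<in>tangent_space A p.
       g p (J p x) (J p y) = - g p x y \<and>
       g' p x y = associated_tensor J g p x y)"

text \<open>\<open>G1\<close>, \<open>G2\<close>, \<open>G3\<close> are the tensors associated with \<open>G\<close> by \<open>J1\<close>, \<open>J2\<close>, \<open>J3\<close>.\<close>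
definition almost_hypercomplex_HN_manifold :: "nat \<Rightarrow> ('a, 'e::euclidean_space) chart set \<Rightarrow>
    ('a \<Rightarrow> ('a, 'e) tvec \<Rightarrow> ('a, 'e) tvec) \<Rightarrow>
    ('a \<Rightarrow> ('a, 'e) tvec \<Rightarrow> ('a, 'e) tvec) \<Rightarrow>
    ('a \<Rightarrow> ('a, 'e) tvec \<Rightarrow> ('a, 'e) tvec) \<Rightarrow>
    ('a \<Rightarrow> ('a, 'e) tvec \<Rightarrow> ('a, 'e) tvec \<Rightarrow> real) \<Rightarrow>
    ('a \<Rightarrow> ('a, 'e) tvec \<Rightarrow> ('a, 'e) tvec \<Rightarrow> real) \<Rightarrow>
    ('a \<Rightarrow> ('a, 'e) tvec \<Rightarrow> ('a, 'e) tvec \<Rightarrow> real) \<Rightarrow>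
    ('a \<Rightarrow> ('a, 'e) tvec \<Rightarrow> ('a, 'e) tvec \<Rightarrow> real) \<Rightarrow> bool"
  where "almost_hypercomplex_HN_manifold n A J1 J2 J3 G G1 G2 G3 \<longleftrightarrow>
    smooth_manifold A \<and> DIM('e) = 4 * n \<and>
    (\<forall>J\<in>{J1, J2, J3}. almost_complex_structure A J) \<and>
    (\<forall>(Ja, Jb, Jc)\<in>{(J1, J2, J3), (J2, J3, J1), (J3, J1, J2)}.
       \<forall>p\<in>carrier A. \<forall>x\<in>tangent_space A p.
         Ja p x = Jb p (Jc p x) \<and> Ja p x = - Jc p (Jb p x)) \<and>
    pseudo_riemannian_metric A G \<and>
    (\<forall>p\<in>carrier A. has_signature (tangent_space A p) (G p) (2 * n) (2 * n)) \<and>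
    (\<forall>(J, \<epsilon>)\<in>{(J1, 1), (J2, -1), (J3, -1)}.
       \<forall>p\<in>carrier A. \<forall>x\<in>tangent_space A p. \<forall>y\<in>tangent_space A p.
         G p (J p x) (J p y) = \<epsilon> * G p x y) \<and>
    (\<forall>(J, G')\<in>{(J1, G1), (J2, G2), (J3, G3)}.
       \<forall>p\<in>carrier A. \<forall>x\<in>tangent_space A p. \<forall>y\<in>tangent_space A p.
         G' p x y = associated_tensor J G p x y)"


section \<open>The tangent bundle, horizontal and vertical lifts\<close>

text \<open>Points of the tangent bundle are pairs of a point \<open>p\<close> and a tangent vector \<open>v\<close> at \<open>p\<close>. Each
  chart \<open>c\<close> induces the chart sending \<open>(p, v)\<close> to the coordinates of \<open>p\<close> and the components
  of \<open>v\<close>.\<close>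
type_synonym ('a, 'e) tpoint = "'a \<times> ('a, 'e) tvec"

definition tangent_chart :: "('a, 'e::euclidean_space) chart set \<Rightarrow> ('a, 'e) chart \<Rightarrow>
    (('a, 'e) tpoint, 'e \<times> 'e) chart"
  where "tangent_chart A c =
    ({(p, v). p \<in> cdom c \<and> v \<in> tangent_space A p}, \<lambda>(p, v). (cmap c p, v c))"

definition tangent_bundle ::
  "('a, 'e::euclidean_space) chart set \<Rightarrow> (('a, 'e) tpoint, 'e \<times> 'e) chart set"
  where "tangent_bundle A = tangent_chart A ` A"

text \<open>\<open>christoffel A nabla c p \<xi> \<eta>\<close> has the components \<open>\<Gamma>\<^sup>k\<^sub>i\<^sub>j \<xi>\<^sup>i \<eta>\<^sup>j\<close> in the chart \<open>c\<close>.\<close>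
definition christoffel :: "('a, 'e::euclidean_space) chart set \<Rightarrow>
    (('a \<Rightarrow> ('a, 'e) tvec) \<Rightarrow> ('a \<Rightarrow> ('a, 'e) tvec) \<Rightarrow> 'a \<Rightarrow> ('a, 'e) tvec) \<Rightarrow>
    ('a, 'e) chart \<Rightarrow> 'a \<Rightarrow> 'e \<Rightarrow> 'e \<Rightarrow> 'e"
  where "christoffel A nabla c p \<xi> \<eta> = nabla (coord_field A c \<xi>) (coord_field A c \<eta>) p c"

text \<open>The lifts of a tangent vector \<open>u\<close> at \<open>p\<close> to the point \<open>(p, v)\<close> of the tangent bundle. In the
  coordinates \<open>(x\<^sup>k, y\<^sup>k)\<close> induced by any chart, the horizontal lift is
  \<open>u\<^sup>k \<partial>/\<partial>x\<^sup>k - \<Gamma>\<^sup>k\<^sub>i\<^sub>j u\<^sup>i v\<^sup>j \<partial>/\<partial>y\<^sup>k\<close> and the vertical lift is \<open>u\<^sup>k \<partial>/\<partial>y\<^sup>k\<close>.\<close>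
definition hlift :: "('a, 'e::euclidean_space) chart set \<Rightarrow>
    (('a \<Rightarrow> ('a, 'e) tvec) \<Rightarrow> ('a \<Rightarrow> ('a, 'e) tvec) \<Rightarrow> 'a \<Rightarrow> ('a, 'e) tvec) \<Rightarrow>
    ('a, 'e) tpoint \<Rightarrow> ('a, 'e) tvec \<Rightarrow> (('a, 'e) tpoint, 'e \<times> 'e) tvec"
  where "hlift A nabla = (\<lambda>(p, v) u. THE w.
    w \<in> tangent_space (tangent_bundle A) (p, v) \<and>
    (\<forall>c\<in>A. p \<in> cdom c \<longrightarrow>
       w (tangent_chart A c) = (u c, - christoffel A nabla c p (u c) (v c))))"

definition vlift :: "('a, 'e::euclidean_space) chart set \<Rightarrow>
    ('a, 'e) tpoint \<Rightarrow> ('a, 'e) tvec \<Rightarrow> (('a, 'e) tpoint, 'e \<times> 'e) tvec"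
  where "vlift A = (\<lambda>(p, v) u. THE w.
    w \<in> tangent_space (tangent_bundle A) (p, v) \<and>
    (\<forall>c\<in>A. p \<in> cdom c \<longrightarrow> w (tangent_chart A c) = (0, u c)))"

definition hor_lift :: "('a, 'e::euclidean_space) chart set \<Rightarrow>
    (('a \<Rightarrow> ('a, 'e) tvec) \<Rightarrow> ('a \<Rightarrow> ('a, 'e) tvec) \<Rightarrow> 'a \<Rightarrow> ('a, 'e) tvec) \<Rightarrow>
    ('a \<Rightarrow> ('a, 'e) tvec) \<Rightarrow> ('a, 'e) tpoint \<Rightarrow> (('a, 'e) tpoint, 'e \<times> 'e) tvec"
  where "hor_lift A nabla X q = hlift A nabla q (X (fst q))"

definition ver_lift :: "('a, 'e::euclidean_space) chart set \<Rightarrow>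
    ('a \<Rightarrow> ('a, 'e) tvec) \<Rightarrow> ('a, 'e) tpoint \<Rightarrow> (('a, 'e) tpoint, 'e \<times> 'e) tvec"
  where "ver_lift A X q = vlift A q (X (fst q))"

text \<open>Every tangent vector \<open>w\<close> of the tangent bundle at \<open>q = (p, v)\<close> is uniquely the sum of the
  horizontal lift of \<open>hpart w\<close> and the vertical lift of \<open>vpart w\<close>.\<close>
definition hpart :: "('a, 'e::euclidean_space) chart set \<Rightarrow>
    (('a \<Rightarrow> ('a, 'e) tvec) \<Rightarrow> ('a \<Rightarrow> ('a, 'e) tvec) \<Rightarrow> 'a \<Rightarrow> ('a, 'e) tvec) \<Rightarrow>
    ('a, 'e) tpoint \<Rightarrow> (('a, 'e) tpoint, 'e \<times> 'e) tvec \<Rightarrow> ('a, 'e) tvec"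
  where "hpart A nabla q w = (THE x. x \<in> tangent_space A (fst q) \<and>
    (\<exists>y\<in>tangent_space A (fst q). w = hlift A nabla q x + vlift A q y))"

definition vpart :: "('a, 'e::euclidean_space) chart set \<Rightarrow>
    (('a \<Rightarrow> ('a, 'e) tvec) \<Rightarrow> ('a \<Rightarrow> ('a, 'e) tvec) \<Rightarrow> 'a \<Rightarrow> ('a, 'e) tvec) \<Rightarrow>
    ('a, 'e) tpoint \<Rightarrow> (('a, 'e) tpoint, 'e \<times> 'e) tvec \<Rightarrow> ('a, 'e) tvec"
  where "vpart A nabla q w = (THE y. y \<in> tangent_space A (fst q) \<and>
    (\<exists>x\<in>tangent_space A (fst q). w = hlift A nabla q x + vlift A q y))"


section \<open>The structure on the tangent bundle\<close>

text \<open>The tensor fields determined by linearity from their values on horizontal and vertical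
  lifts.\<close>
definition TM_J1 :: "('a, 'e::euclidean_space) chart set \<Rightarrow>
    (('a \<Rightarrow> ('a, 'e) tvec) \<Rightarrow> ('a \<Rightarrow> ('a, 'e) tvec) \<Rightarrow> 'a \<Rightarrow> ('a, 'e) tvec) \<Rightarrow>
    ('a \<Rightarrow> ('a, 'e) tvec \<Rightarrow> ('a, 'e) tvec) \<Rightarrow>
    ('a, 'e) tpoint \<Rightarrow> (('a, 'e) tpoint, 'e \<times> 'e) tvec \<Rightarrow> (('a, 'e) tpoint, 'e \<times> 'e) tvec"
  where "TM_J1 A nabla J q w =
    - hlift A nabla q (J (fst q) (hpart A nabla q w)) + vlift A q (J (fst q) (vpart A nabla q w))"

definition TM_J2 :: "('a, 'e::euclidean_space) chart set \<Rightarrow>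
    (('a \<Rightarrow> ('a, 'e) tvec) \<Rightarrow> ('a \<Rightarrow> ('a, 'e) tvec) \<Rightarrow> 'a \<Rightarrow> ('a, 'e) tvec) \<Rightarrow>
    ('a, 'e) tpoint \<Rightarrow> (('a, 'e) tpoint, 'e \<times> 'e) tvec \<Rightarrow> (('a, 'e) tpoint, 'e \<times> 'e) tvec"
  where "TM_J2 A nabla q w =
    vlift A q (hpart A nabla q w) - hlift A nabla q (vpart A nabla q w)"

definition TM_J3 :: "('a, 'e::euclidean_space) chart set \<Rightarrow>
    (('a \<Rightarrow> ('a, 'e) tvec) \<Rightarrow> ('a \<Rightarrow> ('a, 'e) tvec) \<Rightarrow> 'a \<Rightarrow> ('a, 'e) tvec) \<Rightarrow>
    ('a \<Rightarrow> ('a, 'e) tvec \<Rightarrow> ('a, 'e) tvec) \<Rightarrow>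
    ('a, 'e) tpoint \<Rightarrow> (('a, 'e) tpoint, 'e \<times> 'e) tvec \<Rightarrow> (('a, 'e) tpoint, 'e \<times> 'e) tvec"
  where "TM_J3 A nabla J q w =
    vlift A q (J (fst q) (hpart A nabla q w)) + hlift A nabla q (J (fst q) (vpart A nabla q w))"

definition TM_metric :: "('a, 'e::euclidean_space) chart set \<Rightarrow>
    (('a \<Rightarrow> ('a, 'e) tvec) \<Rightarrow> ('a \<Rightarrow> ('a, 'e) tvec) \<Rightarrow> 'a \<Rightarrow> ('a, 'e) tvec) \<Rightarrow>
    ('a \<Rightarrow> ('a, 'e) tvec \<Rightarrow> ('a, 'e) tvec \<Rightarrow> real) \<Rightarrow>
    ('a, 'e) tpoint \<Rightarrow> (('a, 'e) tpoint, 'e \<times> 'e) tvec \<Rightarrow> (('a, 'e) tpoint, 'e \<times> 'e) tvec \<Rightarrow> real"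
  where "TM_metric A nabla g q w z =
    g (fst q) (hpart A nabla q w) (vpart A nabla q z) +
    g (fst q) (vpart A nabla q w) (hpart A nabla q z)"

end

theory Submission
  imports Defs
begin

text \<open>
  Everything rests on the splitting of the tangent space of \<open>TM\<close> at \<open>q = (p, v)\<close> into horizontal and
  vertical vectors: \<open>lift q x y\<close>, the horizontal lift of \<open>x\<close> plus the vertical lift of \<open>y\<close>, is a linear
  bijection from pairs of tangent vectors at \<open>p\<close> onto the tangent vectors at \<open>q\<close>. Through it the
  structures become
  \<open>J\<^sub>1 (x, y) = (- J x, J y)\<close>, \<open>J\<^sub>2 (x, y) = (- y, x)\<close>, \<open>J\<^sub>3 (x, y) = (J y, J x)\<close> and
  \<open>G (x, y) (x', y') = g x y' + g y x'\<close>,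
  and the quaternionic relations, the compatibility of \<open>G\<close> with the \<open>J\<^sub>\<alpha>\<close> and the nondegeneracy of \<open>G\<close>
  are immediate from \<open>J\<^sup>2 = - I\<close>, \<open>g (J x) (J y) = - g x y\<close> and the nondegeneracy of \<open>g\<close>.

  What takes work is that these objects are well defined and smooth. A chart of \<open>M\<close> induces a chart of
  \<open>TM\<close>, whose changes of coordinates are \<open>(x, y) \<mapsto> (\<phi> x, D\<phi>(x) y)\<close>. They are smooth, so \<open>TM\<close> is
  a manifold, but the derivative of such a change contains the second derivative of \<open>\<phi>\<close>
  (\<open>dchg_TC\<close>). The vector with components \<open>(u, - \<Gamma>(u, v))\<close> is therefore independent of the chart only
  because the Christoffel symbols pick up the same second derivative under \<open>\<phi>\<close> (\<open>christoffel_change\<close>).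
  This follows from the axioms of a linear connection once one knows that the value of \<open>nabla X Y\<close> at a
  point depends only on \<open>X\<close> and \<open>Y\<close> near this point (\<open>nabla_cong\<close>): a coordinate field of one chart is
  expanded in the coordinate fields of another, and the Leibniz rule differentiates the coefficients.

  In induced coordinates \<open>(x, y)\<close> the vertical part of a constant vector \<open>(a, b)\<close> is
  \<open>b + \<Gamma>\<^sub>x(a, y)\<close>. Since \<open>\<Gamma>\<close>, \<open>J\<close> and \<open>g\<close> are smooth for constant arguments and linear in each
  argument, they are smooth for smoothly varying arguments too, and this gives smooth components of
  the \<open>J\<^sub>\<alpha>\<close> and of \<open>G\<close> (\<open>tensor11_block\<close>, \<open>pseudo_riemannian_TM_metric\<close>).

  The signature is neutral because horizontal and vertical vectors form complementary isotropic
  subspaces: a basis of the one and a suitable multiple of its dual basis in the other form hyperbolic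
  pairs, whose sums and differences make up an orthonormal basis (\<open>has_signature_hyperbolic\<close>).
\<close>


section \<open>Calculus of smooth maps\<close>

lemma has_derivative_cong_open:
  assumes "open S" "x \<in> S" "\<And>y. y \<in> S \<Longrightarrow> f y = g y"
  shows "(f has_derivative D) (at x) \<longleftrightarrow> (g has_derivative D) (at x)"
  using has_derivative_transform_within_open[OF _ assms(1,2)] assms(3) by metis

lemma frechet_derivative_cong_open:
  assumes "open S" "x \<in> S" "\<And>y. y \<in> S \<Longrightarrow> f y = g y"
  shows "frechet_derivative f (at x) = frechet_derivative g (at x)"
  unfolding frechet_derivative_def using has_derivative_cong_open[OF assms] by simp

lemma differentiable_cong_open:
  assumes "open S" "x \<in> S" "\<And>y. y \<in> S \<Longrightarrow> f y = g y"
  shows "f differentiable (at x) \<longleftrightarrow> g differentiable (at x)"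
  unfolding differentiable_def using has_derivative_cong_open[OF assms] by simp

lemma Ck_on_cong:
  assumes "open S" "\<And>x. x \<in> S \<Longrightarrow> f x = g x"
  shows "Ck_on k S f \<longleftrightarrow> Ck_on k S g"
  using assms(2)
proof (induction k arbitrary: f g)
  case 0
  then show ?case by (simp cong: continuous_on_cong)
next
  case (Suc k)
  have "Ck_on k S (\<lambda>x. frechet_derivative f (at x) v) \<longleftrightarrow>
    Ck_on k S (\<lambda>x. frechet_derivative g (at x) v)" for v
    by (rule Suc.IH) (simp add: frechet_derivative_cong_open[OF assms(1) _ Suc.prems])
  then show ?case
    using differentiable_cong_open[OF assms(1) _ Suc.prems] by auto
qed

lemma Ck_on_subset: "Ck_on k S f \<Longrightarrow> T \<subseteq> S \<Longrightarrow> Ck_on k T f"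
  by (induction k arbitrary: f) (auto intro: continuous_on_subset)

text \<open>The definition of \<open>Ck_on\<close> asks for continuity of the highest derivatives only; continuity of the
  lower ones comes from differentiability.\<close>
lemma Ck_on_SucD: "Ck_on (Suc k) S f \<Longrightarrow> Ck_on k S f"
proof (induction k arbitrary: f)
  case 0
  then show ?case
    by (auto intro!: differentiable_imp_continuous_on simp: differentiable_on_def
        intro: differentiable_at_imp_differentiable_on)
next
  case (Suc k)
  then show ?case by (metis Ck_on.simps(2))
qed

lemma Ck_on_SucI:
  assumes "open S" "\<And>x. x \<in> S \<Longrightarrow> (f has_derivative D x) (at x)"
    and "\<And>v. Ck_on k S (\<lambda>x. D x v)"
  shows "Ck_on (Suc k) S f"
proof -
  have "Ck_on k S (\<lambda>x. frechet_derivative f (at x) v)" for v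
    using Ck_on_cong[OF assms(1), of "\<lambda>x. D x v" "\<lambda>x. frechet_derivative f (at x) v"]
      frechet_derivative_at[OF assms(2)] assms(3) by metis
  then show ?thesis using assms(2) by (auto simp: differentiable_def)
qed

lemma Ck_on_Suc_has_derivative:
  "Ck_on (Suc k) S f \<Longrightarrow> x \<in> S \<Longrightarrow> (f has_derivative frechet_derivative f (at x)) (at x)"
  using frechet_derivative_works by auto

lemma Ck_on_const: "Ck_on k S (\<lambda>x. c)"
  by (induction k arbitrary: c) auto

lemma Ck_on_bounded_linear_compose:
  assumes "bounded_linear L" "open S" "Ck_on k S f"
  shows "Ck_on k S (\<lambda>x. L (f x))"
  using assms(3)
proof (induction k arbitrary: f)
  case 0
  then show ?case using bounded_linear.continuous_on[OF assms(1)] by auto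
next
  case (Suc k)
  show ?case
  proof (rule Ck_on_SucI[OF assms(2)])
    show "((\<lambda>x. L (f x)) has_derivative (\<lambda>v. L (frechet_derivative f (at x) v))) (at x)"
      if "x \<in> S" for x
      using bounded_linear.has_derivative[OF assms(1) Ck_on_Suc_has_derivative[OF Suc.prems that]] .
    show "Ck_on k S (\<lambda>x. L (frechet_derivative f (at x) v))" for v
      using Suc by auto
  qed
qed

lemma Ck_on_add:
  assumes "open S" "Ck_on k S f" "Ck_on k S g"
  shows "Ck_on k S (\<lambda>x. f x + g x)"
  using assms(2,3)
proof (induction k arbitrary: f g)
  case 0
  then show ?case by (auto intro: continuous_on_add)
next
  case (Suc k)
  show ?case
  proof (rule Ck_on_SucI[OF assms(1)])
    show "((\<lambda>x. f x + g x) has_derivative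
        (\<lambda>v. frechet_derivative f (at x) v + frechet_derivative g (at x) v)) (at x)"
      if "x \<in> S" for x
      by (intro has_derivative_add Ck_on_Suc_has_derivative[OF _ that]) (fact Suc.prems)+
    show "Ck_on k S (\<lambda>x. frechet_derivative f (at x) v + frechet_derivative g (at x) v)" for v
      using Suc by auto
  qed
qed

lemma Ck_on_scaleR:
  assumes "open S" "Ck_on k S f" "Ck_on k S g"
  shows "Ck_on k S (\<lambda>x. f x *\<^sub>R g x)"
  using assms(2,3)
proof (induction k arbitrary: f g)
  case 0
  then show ?case by (auto intro: continuous_on_scaleR)
next
  case (Suc k)
  show ?case
  proof (rule Ck_on_SucI[OF assms(1)])
    show "((\<lambda>x. f x *\<^sub>R g x) has_derivative
        (\<lambda>v. f x *\<^sub>R frechet_derivative g (at x) v + frechet_derivative f (at x) v *\<^sub>R g x)) (at x)"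
      if "x \<in> S" for x
      by (intro has_derivative_scaleR Ck_on_Suc_has_derivative[OF _ that]) (fact Suc.prems)+
    show "Ck_on k S
        (\<lambda>x. f x *\<^sub>R frechet_derivative g (at x) v + frechet_derivative f (at x) v *\<^sub>R g x)" for v
      by (intro Ck_on_add[OF assms(1)] Suc.IH) (use Suc.prems Ck_on_SucD in auto)
  qed
qed

lemma Ck_on_sum:
  assumes "open S" "\<And>i. i \<in> I \<Longrightarrow> Ck_on k S (f i)"
  shows "Ck_on k S (\<lambda>x. \<Sum>i\<in>I. f i x)"
  using assms(2)
  by (induction I rule: infinite_finite_induct) (auto intro: Ck_on_const Ck_on_add[OF assms(1)])

lemma linear_Basis_expansion:
  fixes L :: "'e::euclidean_space \<Rightarrow> 'b::real_vector"
  assumes "linear L"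
  shows "L y = (\<Sum>b\<in>Basis. (y \<bullet> b) *\<^sub>R L b)"
  using linear_sum[OF assms, of "\<lambda>b. (y \<bullet> b) *\<^sub>R b" Basis]
  by (simp add: euclidean_representation linear_cmul[OF assms])

text \<open>Expanding the inner derivative in an orthonormal basis turns the chain rule into a sum of
  products, so that the induction stays within functions of the same kind.\<close>
lemma Ck_on_compose:
  fixes f :: "'a::real_normed_vector \<Rightarrow> 'e::euclidean_space"
  assumes "open S" "open T" "f ` S \<subseteq> T" "Ck_on k S f" "Ck_on k T g"
  shows "Ck_on k S (\<lambda>x. g (f x))"
  using assms(4,5)
proof (induction k arbitrary: g)
  case 0
  then show ?case using continuous_on_compose2[OF _ _ assms(3)] by auto
next
  case (Suc k)
  let ?D = "\<lambda>x v. frechet_derivative f (at x) v"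
  show ?case
  proof (rule Ck_on_SucI[OF assms(1)])
    fix x assume x: "x \<in> S"
    then have fx: "f x \<in> T" using assms(3) by auto
    note g' = Ck_on_Suc_has_derivative[OF Suc.prems(2) fx]
    show "((\<lambda>x. g (f x)) has_derivative
        (\<lambda>v. \<Sum>b\<in>Basis. (?D x v \<bullet> b) *\<^sub>R frechet_derivative g (at (f x)) b)) (at x)"
      using has_derivative_compose[OF Ck_on_Suc_has_derivative[OF Suc.prems(1) x] g']
      unfolding linear_Basis_expansion[OF has_derivative_linear[OF g'], of "?D x _"] .
  next
    fix v
    have "Ck_on k S (\<lambda>x. ?D x v \<bullet> b)" for b
      using Ck_on_bounded_linear_compose[OF bounded_linear_inner_left assms(1), of k _ b] Suc.prems(1)
      by auto
    moreover have "Ck_on k S (\<lambda>x. frechet_derivative g (at (f x)) b)" for b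
      using Suc.IH[OF Ck_on_SucD[OF Suc.prems(1)]] Suc.prems(2) by auto
    ultimately show "Ck_on k S (\<lambda>x. \<Sum>b\<in>Basis. (?D x v \<bullet> b) *\<^sub>R frechet_derivative g (at (f x)) b)"
      by (intro Ck_on_sum Ck_on_scaleR assms(1))
  qed
qed

lemma smooth_on_cong:
  assumes "open S" "\<And>x. x \<in> S \<Longrightarrow> f x = g x"
  shows "smooth_on S f \<longleftrightarrow> smooth_on S g"
  using Ck_on_cong[OF assms] by (simp add: smooth_on_def)

lemma smooth_on_subset: "smooth_on S f \<Longrightarrow> T \<subseteq> S \<Longrightarrow> smooth_on T f"
  by (auto simp: smooth_on_def intro: Ck_on_subset)

lemma smooth_on_const: "smooth_on S (\<lambda>x. c)"
  by (simp add: smooth_on_def Ck_on_const)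

lemma smooth_on_bounded_linear_compose:
  "bounded_linear L \<Longrightarrow> open S \<Longrightarrow> smooth_on S f \<Longrightarrow> smooth_on S (\<lambda>x. L (f x))"
  by (simp add: smooth_on_def Ck_on_bounded_linear_compose)

lemma smooth_on_add:
  "open S \<Longrightarrow> smooth_on S f \<Longrightarrow> smooth_on S g \<Longrightarrow> smooth_on S (\<lambda>x. f x + g x)"
  by (simp add: smooth_on_def Ck_on_add)

lemma smooth_on_scaleR:
  "open S \<Longrightarrow> smooth_on S f \<Longrightarrow> smooth_on S g \<Longrightarrow> smooth_on S (\<lambda>x. f x *\<^sub>R g x)"
  by (simp add: smooth_on_def Ck_on_scaleR)

lemma smooth_on_uminus: "open S \<Longrightarrow> smooth_on S f \<Longrightarrow> smooth_on S (\<lambda>x. - f x)"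
  using smooth_on_bounded_linear_compose[OF bounded_linear_minus[OF bounded_linear_ident]] .

lemma smooth_on_diff:
  "open S \<Longrightarrow> smooth_on S f \<Longrightarrow> smooth_on S g \<Longrightarrow> smooth_on S (\<lambda>x. f x - g x)"
  using smooth_on_add[of S f "\<lambda>x. - g x"] smooth_on_uminus by auto

lemma smooth_on_sum:
  "open S \<Longrightarrow> (\<And>i. i \<in> I \<Longrightarrow> smooth_on S (f i)) \<Longrightarrow> smooth_on S (\<lambda>x. \<Sum>i\<in>I. f i x)"
  by (simp add: smooth_on_def Ck_on_sum)

lemma smooth_on_compose:
  fixes f :: "'a::real_normed_vector \<Rightarrow> 'e::euclidean_space"
  assumes "open S" "open T" "f ` S \<subseteq> T" "smooth_on S f" "smooth_on T g"
  shows "smooth_on S (\<lambda>x. g (f x))"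
  using assms by (auto simp: smooth_on_def intro: Ck_on_compose)

lemma smooth_on_ident: "smooth_on S (\<lambda>x. x)"
proof -
  have "Ck_on k S (\<lambda>x. x)" for k
  proof (cases k)
    case (Suc m)
    have "Ck_on m UNIV (\<lambda>x. v)" for v by (rule Ck_on_const)
    then show ?thesis using Ck_on_subset[OF Ck_on_SucI[OF open_UNIV has_derivative_ident]] Suc by blast
  qed simp
  then show ?thesis by (simp add: smooth_on_def)
qed

lemma smooth_on_fst: "open S \<Longrightarrow> smooth_on S fst"
  using smooth_on_bounded_linear_compose[OF bounded_linear_fst _ smooth_on_ident] .

lemma smooth_on_compose_fst:
  fixes f :: "'e::euclidean_space \<Rightarrow> 'b::real_normed_vector"
  assumes "open S" "smooth_on S f"
  shows "smooth_on (S \<times> (UNIV :: 'c::real_normed_vector set)) (\<lambda>z. f (fst z))"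
proof -
  have op: "open (S \<times> (UNIV :: 'c set))" using assms(1) by (simp add: open_Times)
  show ?thesis by (rule smooth_on_compose[OF op assms(1) _ smooth_on_fst[OF op] assms(2)]) auto
qed

lemma smooth_on_snd: "open S \<Longrightarrow> smooth_on S snd"
  using smooth_on_bounded_linear_compose[OF bounded_linear_snd _ smooth_on_ident] .

lemma smooth_on_Pair:
  assumes "open S" "smooth_on S f" "smooth_on S g"
  shows "smooth_on S (\<lambda>x. (f x, g x))"
proof -
  have "smooth_on S (\<lambda>x. (f x, 0) + (0, g x))"
    by (intro smooth_on_add assms(1)
        smooth_on_bounded_linear_compose[of "\<lambda>y. (y, 0)"] smooth_on_bounded_linear_compose[of "\<lambda>y. (0, y)"]
        assms bounded_linear_Pair bounded_linear_ident bounded_linear_zero)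
  then show ?thesis by simp
qed

lemma smooth_on_has_derivative:
  "smooth_on S f \<Longrightarrow> x \<in> S \<Longrightarrow> (f has_derivative frechet_derivative f (at x)) (at x)"
  unfolding smooth_on_def using Ck_on_Suc_has_derivative by blast

lemma smooth_on_frechet_derivative:
  "smooth_on S f \<Longrightarrow> smooth_on S (\<lambda>x. frechet_derivative f (at x) v)"
  unfolding smooth_on_def by (metis Ck_on.simps(2))

lemma smooth_on_imp_continuous_on: "smooth_on S f \<Longrightarrow> continuous_on S f"
  unfolding smooth_on_def by (metis Ck_on.simps(1))

text \<open>Smoothness of tensor fields and Christoffel symbols is a statement about constant arguments. By
  expansion in a basis it extends to smoothly varying arguments.\<close>
lemma smooth_on_linear_family:
  fixes L :: "'a::real_normed_vector \<Rightarrow> 'e::euclidean_space \<Rightarrow> 'b::real_normed_vector"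
  assumes "open S" "\<And>x. x \<in> S \<Longrightarrow> linear (L x)" "\<And>b. smooth_on S (\<lambda>x. L x b)" "smooth_on S f"
  shows "smooth_on S (\<lambda>x. L x (f x))"
proof -
  have "smooth_on S (\<lambda>x. f x \<bullet> b)" for b
    by (rule smooth_on_bounded_linear_compose[OF bounded_linear_inner_left assms(1,4)])
  then have "smooth_on S (\<lambda>x. \<Sum>b\<in>Basis. (f x \<bullet> b) *\<^sub>R L x b)"
    by (intro smooth_on_sum smooth_on_scaleR assms(1,3))
  moreover have "smooth_on S (\<lambda>x. L x (f x)) \<longleftrightarrow> smooth_on S (\<lambda>x. \<Sum>b\<in>Basis. (f x \<bullet> b) *\<^sub>R L x b)"
    by (intro smooth_on_cong linear_Basis_expansion assms)
  ultimately show ?thesis by simp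
qed

lemma smooth_on_bilinear_family:
  fixes B :: "'a::real_normed_vector \<Rightarrow> 'e::euclidean_space \<Rightarrow> 'f::euclidean_space \<Rightarrow> 'b::real_normed_vector"
  assumes "open S" "\<And>x b. x \<in> S \<Longrightarrow> linear (B x b)" "\<And>x b. x \<in> S \<Longrightarrow> linear (\<lambda>a. B x a b)"
    and "\<And>a b. smooth_on S (\<lambda>x. B x a b)" "smooth_on S f" "smooth_on S h"
  shows "smooth_on S (\<lambda>x. B x (f x) (h x))"
  by (rule smooth_on_linear_family[OF assms(1) _ _ assms(6)], erule assms(2),
      rule smooth_on_linear_family[OF assms(1) _ _ assms(5)], erule assms(3), rule assms(4))

text \<open>The product rule for evaluating a family of linear maps at a moving argument.\<close>
lemma has_derivative_linear_family:
  fixes L :: "'a::real_normed_vector \<Rightarrow> 'e::euclidean_space \<Rightarrow> 'b::real_normed_vector"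
  assumes "open S" "x \<in> S" "\<And>x. x \<in> S \<Longrightarrow> linear (L x)"
    and D: "\<And>b. ((\<lambda>x. L x b) has_derivative D b) (at x)"
  shows "((\<lambda>(x, y). L x y) has_derivative (\<lambda>(a, b). D y a + L x b)) (at (x, y))"
proof -
  let ?E = "\<lambda>a. \<Sum>b\<in>Basis. (y \<bullet> b) *\<^sub>R D b a"
  have E: "D y = ?E"
  proof -
    have "((\<lambda>x. \<Sum>b\<in>Basis. (y \<bullet> b) *\<^sub>R L x b) has_derivative ?E) (at x)"
      by (intro has_derivative_sum has_derivative_scaleR_right D)
    then have "((\<lambda>x. L x y) has_derivative ?E) (at x)"
      by (rule has_derivative_transform_within_open[OF _ assms(1,2)])
        (rule linear_Basis_expansion[OF assms(3), symmetric])
    then show ?thesis using has_derivative_unique D by blast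
  qed
  have "((\<lambda>z. \<Sum>b\<in>Basis. (snd z \<bullet> b) *\<^sub>R L (fst z) b) has_derivative
      (\<lambda>z. \<Sum>b\<in>Basis. (snd (x, y) \<bullet> b) *\<^sub>R D b (fst z) + (snd z \<bullet> b) *\<^sub>R L (fst (x, y)) b)) (at (x, y))"
  proof (intro has_derivative_sum has_derivative_scaleR)
    show "((\<lambda>z. snd z \<bullet> b) has_derivative (\<lambda>z. snd z \<bullet> b)) (at (x, y))" for b :: 'e
      by (auto intro!: derivative_eq_intros)
    have "(fst has_derivative fst) (at (x, y))" by (auto intro!: derivative_eq_intros)
    then show "((\<lambda>z. L (fst z) b) has_derivative (\<lambda>z. D b (fst z))) (at (x, y))" for b
      using has_derivative_compose[of fst fst "(x, y)" UNIV "\<lambda>x. L x b" "D b"] D by simp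
  qed
  moreover have "(\<Sum>b\<in>Basis. (snd (x, y) \<bullet> b) *\<^sub>R D b (fst z) + (snd z \<bullet> b) *\<^sub>R L (fst (x, y)) b) =
      D y (fst z) + L x (snd z)" for z
    using linear_Basis_expansion[OF assms(3)[OF assms(2)], of "snd z"] by (simp add: E sum.distrib)
  ultimately have "((\<lambda>z. \<Sum>b\<in>Basis. (snd z \<bullet> b) *\<^sub>R L (fst z) b) has_derivative
      (\<lambda>z. D y (fst z) + L x (snd z))) (at (x, y))" by simp
  then have "((\<lambda>z. L (fst z) (snd z)) has_derivative (\<lambda>z. D y (fst z) + L x (snd z))) (at (x, y))"
  proof (rule has_derivative_transform_within_open)
    show "open (S \<times> UNIV)" "(x, y) \<in> S \<times> UNIV" using assms(1,2) by (auto intro: open_Times)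
    show "(\<Sum>b\<in>Basis. (snd z \<bullet> b) *\<^sub>R L (fst z) b) = L (fst z) (snd z)" if "z \<in> S \<times> UNIV" for z
      using that by (intro linear_Basis_expansion[OF assms(3), symmetric]) auto
  qed
  then show ?thesis by (simp add: case_prod_beta')
qed


section \<open>Tangent spaces and coordinate fields\<close>

lemma scaleR_fun_apply [simp]: "(r *\<^sub>R f) x = r *\<^sub>R f x"
  by (simp add: scaleR_fun_def)

locale atlas =
  fixes A :: "('a, 'e::euclidean_space) chart set"
  assumes atlas: "smooth_atlas A"
begin

abbreviation chg :: "('a, 'e) chart \<Rightarrow> ('a, 'e) chart \<Rightarrow> 'e \<Rightarrow> 'e"
  where "chg c d \<equiv> cmap d \<circ> cinv c"

abbreviation dchg :: "('a, 'e) chart \<Rightarrow> ('a, 'e) chart \<Rightarrow> 'e \<Rightarrow> 'e \<Rightarrow> 'e"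
  where "dchg c d x \<equiv> frechet_derivative (chg c d) (at x)"

lemma inj_cmap: "c \<in> A \<Longrightarrow> inj_on (cmap c) (cdom c)"
  using atlas by (auto simp: smooth_atlas_def)

lemma open_cmap: "c \<in> A \<Longrightarrow> open (cmap c ` cdom c)"
  using atlas by (auto simp: smooth_atlas_def)

lemma open_cmap_Int: "c \<in> A \<Longrightarrow> d \<in> A \<Longrightarrow> open (cmap c ` (cdom c \<inter> cdom d))"
  using atlas by (auto simp: smooth_atlas_def)

lemma smooth_chg: "c \<in> A \<Longrightarrow> d \<in> A \<Longrightarrow> smooth_on (cmap c ` (cdom c \<inter> cdom d)) (chg c d)"
  using atlas unfolding smooth_atlas_def by blast

lemma cinv_cmap [simp]: "c \<in> A \<Longrightarrow> p \<in> cdom c \<Longrightarrow> cinv c (cmap c p) = p"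
  by (simp add: cinv_def inj_cmap)

lemma chg_has_derivative:
  "c \<in> A \<Longrightarrow> d \<in> A \<Longrightarrow> p \<in> cdom c \<Longrightarrow> p \<in> cdom d \<Longrightarrow>
    (chg c d has_derivative dchg c d (cmap c p)) (at (cmap c p))"
  by (rule smooth_on_has_derivative[OF smooth_chg]) auto

lemma linear_dchg:
  "c \<in> A \<Longrightarrow> d \<in> A \<Longrightarrow> p \<in> cdom c \<Longrightarrow> p \<in> cdom d \<Longrightarrow> linear (dchg c d (cmap c p))"
  by (rule has_derivative_linear[OF chg_has_derivative])

lemma dchg_id [simp]:
  assumes "c \<in> A" "p \<in> cdom c"
  shows "dchg c c (cmap c p) \<xi> = \<xi>"
proof -
  have "dchg c c (cmap c p) = frechet_derivative (\<lambda>x. x) (at (cmap c p))"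
    by (rule frechet_derivative_cong_open[OF open_cmap[OF assms(1)]]) (use assms in auto)
  then show ?thesis by simp
qed

text \<open>The cocycle identity, which makes \<open>coord_field\<close> a family of tangent vectors.\<close>
lemma dchg_compose:
  assumes "c \<in> A" "d \<in> A" "e \<in> A" and p: "p \<in> cdom c" "p \<in> cdom d" "p \<in> cdom e"
  shows "dchg d e (cmap d p) (dchg c d (cmap c p) \<xi>) = dchg c e (cmap c p) \<xi>"
proof -
  let ?x = "cmap c p" and ?S = "cmap c ` (cdom c \<inter> cdom d)"
  have "(chg d e has_derivative dchg d e (cmap d p)) (at (chg c d ?x))"
    using chg_has_derivative[OF assms(2,3) p(2,3)] assms by simp
  from has_derivative_compose[OF chg_has_derivative[OF assms(1,2) p(1,2)] this]
  have "((\<lambda>x. chg d e (chg c d x)) has_derivative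
      (\<lambda>\<xi>. dchg d e (cmap d p) (dchg c d ?x \<xi>))) (at ?x)" .
  then have "(chg c e has_derivative (\<lambda>\<xi>. dchg d e (cmap d p) (dchg c d ?x \<xi>))) (at ?x)"
    by (rule has_derivative_transform_within_open[of _ _ _ _ ?S])
      (use assms open_cmap_Int in auto)
  then show ?thesis by (metis frechet_derivative_at)
qed

lemma tangent_space_change:
  "u \<in> tangent_space A p \<Longrightarrow> c \<in> A \<Longrightarrow> d \<in> A \<Longrightarrow> p \<in> cdom c \<Longrightarrow> p \<in> cdom d \<Longrightarrow>
    u d = dchg c d (cmap c p) (u c)"
  unfolding tangent_space_def by blast

lemma tangent_space_outside: "u \<in> tangent_space A p \<Longrightarrow> c \<notin> A \<or> p \<notin> cdom c \<Longrightarrow> u c = 0"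
  unfolding tangent_space_def by blast

lemma tangent_spaceI:
  assumes "\<And>c. c \<notin> A \<or> p \<notin> cdom c \<Longrightarrow> u c = 0"
    and "\<And>c d. c \<in> A \<Longrightarrow> d \<in> A \<Longrightarrow> p \<in> cdom c \<Longrightarrow> p \<in> cdom d \<Longrightarrow> u d = dchg c d (cmap c p) (u c)"
  shows "u \<in> tangent_space A p"
  using assms unfolding tangent_space_def by blast

lemma subspace_tangent_space: "subspace (tangent_space A p)"
proof (rule subspaceI)
  show "0 \<in> tangent_space A p"
    by (rule tangent_spaceI) (simp_all add: linear_0[OF linear_dchg])
  fix u v assume uv: "u \<in> tangent_space A p" "v \<in> tangent_space A p"
  show "u + v \<in> tangent_space A p"
  proof (rule tangent_spaceI)
    show "(u + v) d = dchg c d (cmap c p) ((u + v) c)"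
      if "c \<in> A" "d \<in> A" "p \<in> cdom c" "p \<in> cdom d" for c d
      using tangent_space_change[OF uv(1) that] tangent_space_change[OF uv(2) that]
      by (simp add: linear_add[OF linear_dchg] that)
  qed (auto simp: tangent_space_outside[OF uv(1)] tangent_space_outside[OF uv(2)])
  show "r *\<^sub>R u \<in> tangent_space A p" for r
  proof (rule tangent_spaceI)
    show "(r *\<^sub>R u) d = dchg c d (cmap c p) ((r *\<^sub>R u) c)"
      if "c \<in> A" "d \<in> A" "p \<in> cdom c" "p \<in> cdom d" for c d
      using tangent_space_change[OF uv(1) that]
      by (simp add: linear_cmul[OF linear_dchg] that)
  qed (auto simp: tangent_space_outside[OF uv(1)])
qed

lemmas tangent_space_closed [simp, intro] =
  subspace_add[OF subspace_tangent_space] subspace_diff[OF subspace_tangent_space]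
  subspace_neg[OF subspace_tangent_space] subspace_mul[OF subspace_tangent_space]
  subspace_0[OF subspace_tangent_space]

lemmas zero_tangent = subspace_0[OF subspace_tangent_space]

lemma coord_field_in [simp, intro]:
  "c \<in> A \<Longrightarrow> p \<in> cdom c \<Longrightarrow> coord_field A c \<xi> p \<in> tangent_space A p"
  by (rule tangent_spaceI) (auto simp: coord_field_def dchg_compose)

lemma coord_field_comp [simp]:
  "c \<in> A \<Longrightarrow> p \<in> cdom c \<Longrightarrow> coord_field A c \<xi> p c = \<xi>"
  by (simp add: coord_field_def)

lemma coord_field_self:
  assumes "u \<in> tangent_space A p" "c \<in> A" "p \<in> cdom c"
  shows "coord_field A c (u c) p = u"
proof
  fix d show "coord_field A c (u c) p d = u d"
    using assms tangent_space_change[OF assms(1,2) _ assms(3), of d] tangent_space_outside[OF assms(1), of d]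
    by (auto simp: coord_field_def)
qed

lemma tangent_eqI:
  "u \<in> tangent_space A p \<Longrightarrow> v \<in> tangent_space A p \<Longrightarrow> c \<in> A \<Longrightarrow> p \<in> cdom c \<Longrightarrow> u c = v c \<Longrightarrow> u = v"
  using coord_field_self by metis

lemma linear_coord_field:
  assumes "c \<in> A" "p \<in> cdom c"
  shows "linear (\<lambda>\<xi>. coord_field A c \<xi> p)"
  by (rule linearI; rule tangent_eqI[OF _ _ assms])
    (use assms in auto)

lemma carrier_chart:
  assumes "p \<in> carrier A"
  obtains c where "c \<in> A" "p \<in> cdom c"
  using assms by (auto simp: carrier_def)

lemma smooth_on_cmap_Int_change:
  assumes "c \<in> A" "d \<in> A" "smooth_on (cmap d ` (cdom d \<inter> cdom c)) f"
  shows "smooth_on (cmap c ` (cdom c \<inter> cdom d)) (\<lambda>x. f (chg c d x))"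
  using assms(3)
  by (intro smooth_on_compose[OF open_cmap_Int[OF assms(1,2)] _ _ smooth_chg[OF assms(1,2)]])
    (use open_cmap_Int[OF assms(2,1)] assms(1,2) in auto)

lemma vector_field_coord_field:
  assumes "c \<in> A" "W \<subseteq> cdom c" "\<And>d. d \<in> A \<Longrightarrow> open (cmap d ` (W \<inter> cdom d))"
  shows "vector_field_on A W (coord_field A c \<xi>)"
  unfolding vector_field_on_def
proof (intro conjI ballI)
  show "p \<in> W \<Longrightarrow> coord_field A c \<xi> p \<in> tangent_space A p" for p using assms by auto
  fix d assume d: "d \<in> A"
  have *: "smooth_on (cmap d ` (cdom d \<inter> cdom c)) (\<lambda>x. dchg c d (chg d c x) \<xi>)"
    by (rule smooth_on_cmap_Int_change[OF d assms(1) smooth_on_frechet_derivative[OF smooth_chg[OF assms(1) d]]])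
  have "smooth_on (cmap d ` (W \<inter> cdom d)) (\<lambda>x. dchg c d (chg d c x) \<xi>)"
    by (rule smooth_on_subset[OF *]) (use assms in auto)
  then show "smooth_on (cmap d ` (W \<inter> cdom d)) (\<lambda>x. coord_field A c \<xi> (cinv d x) d)"
    by (subst smooth_on_cong[OF assms(3)[OF d], where g="\<lambda>x. dchg c d (chg d c x) \<xi>"])
      (use d in \<open>auto simp: coord_field_def\<close>)
qed

text \<open>Openness has to be tested in every chart; the transition maps are continuous, so testing it in
  one chart is enough.\<close>
lemma openin_chart_preimage:
  assumes c: "c \<in> A" and U: "open U"
  shows "openin (atlas_topology A) {p \<in> cdom c. cmap c p \<in> U}"
  unfolding openin_atlas_topology[OF atlas]
proof (intro conjI ballI)
  show "{p \<in> cdom c. cmap c p \<in> U} \<subseteq> carrier A" using c by (auto simp: carrier_def)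
  fix d assume d: "d \<in> A"
  have "cmap d ` ({p \<in> cdom c. cmap c p \<in> U} \<inter> cdom d) =
      chg d c -` U \<inter> cmap d ` (cdom d \<inter> cdom c)" using d by auto
  then show "open (cmap d ` ({p \<in> cdom c. cmap c p \<in> U} \<inter> cdom d))"
    using continuous_open_preimage[OF smooth_on_imp_continuous_on[OF smooth_chg[OF d c]] open_cmap_Int[OF d c] U]
    by (simp add: Int_commute)
qed

lemma openin_cdom: "c \<in> A \<Longrightarrow> openin (atlas_topology A) (cdom c)"
  using openin_chart_preimage[OF _ open_UNIV] by simp

lemma topspace_atlas: "topspace (atlas_topology A) = carrier A"
proof
  show "topspace (atlas_topology A) \<subseteq> carrier A"
    using openin_topspace[of "atlas_topology A"] unfolding openin_atlas_topology[OF atlas] by blast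
  show "carrier A \<subseteq> topspace (atlas_topology A)"
    using openin_subset[OF openin_cdom] by (auto simp: carrier_def)
qed

lemma open_cmap_openin:
  "openin (atlas_topology A) W \<Longrightarrow> c \<in> A \<Longrightarrow> open (cmap c ` (W \<inter> cdom c))"
  by (simp add: openin_atlas_topology[OF atlas])

end

text \<open>From left to right, every basic open set contained in some chart domain selects one such chart;
  from right to left, a countable base of the model space is pulled back along the countably many
  charts. In this form second countability passes to the tangent bundle at once.\<close>
lemma (in atlas) second_countable_iff_countable_cover:
  "second_countable (atlas_topology A) \<longleftrightarrow> (\<exists>C\<subseteq>A. countable C \<and> carrier A = \<Union>(cdom ` C))"
proof
  assume "second_countable (atlas_topology A)"
  then obtain B where B: "countable B" "\<And>V. V \<in> B \<Longrightarrow> openin (atlas_topology A) V"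
    "\<And>U x. openin (atlas_topology A) U \<Longrightarrow> x \<in> U \<Longrightarrow> \<exists>V\<in>B. x \<in> V \<and> V \<subseteq> U"
    unfolding second_countable_def by metis
  define C where "C = (\<lambda>V. SOME c. c \<in> A \<and> V \<subseteq> cdom c) ` {V\<in>B. \<exists>c\<in>A. V \<subseteq> cdom c}"
  have C: "(SOME c. c \<in> A \<and> V \<subseteq> cdom c) \<in> A \<and> V \<subseteq> cdom (SOME c. c \<in> A \<and> V \<subseteq> cdom c)"
    if "\<exists>c\<in>A. V \<subseteq> cdom c" for V
    using someI_ex[of "\<lambda>c. c \<in> A \<and> V \<subseteq> cdom c"] that by blast
  show "\<exists>C\<subseteq>A. countable C \<and> carrier A = \<Union>(cdom ` C)"
  proof (intro exI conjI)
    show "C \<subseteq> A"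
    proof
      fix c assume "c \<in> C"
      then obtain V where "c = (SOME c. c \<in> A \<and> V \<subseteq> cdom c)" "\<exists>c\<in>A. V \<subseteq> cdom c"
        unfolding C_def by blast
      then show "c \<in> A" using C[of V] by blast
    qed
    then have "\<Union>(cdom ` C) \<subseteq> carrier A" by (auto simp: carrier_def)
    moreover have "p \<in> \<Union>(cdom ` C)" if p: "p \<in> carrier A" for p
    proof -
      obtain c where c: "c \<in> A" "p \<in> cdom c" using carrier_chart[OF p] by blast
      then obtain V where V: "V \<in> B" "p \<in> V" "V \<subseteq> cdom c" using B(3) openin_cdom by blast
      with C[of V] c show ?thesis unfolding C_def by blast
    qed
    ultimately show "carrier A = \<Union>(cdom ` C)" by blast
    show "countable C" using B(1) by (auto simp: C_def)
  qed
next
  assume "\<exists>C\<subseteq>A. countable C \<and> carrier A = \<Union>(cdom ` C)"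
  then obtain C where C: "C \<subseteq> A" "countable C" "carrier A = \<Union>(cdom ` C)" by blast
  obtain E :: "'e set set" where E: "countable E" "topological_basis E"
    using ex_countable_basis by blast
  define B where "B = (\<lambda>(c, U). {p \<in> cdom c. cmap c p \<in> U}) ` (C \<times> E)"
  show "second_countable (atlas_topology A)"
    unfolding second_countable_def
  proof (intro exI conjI allI ballI impI)
    show "countable B" using C(2) E(1) by (auto simp: B_def)
    show "openin (atlas_topology A) V" if "V \<in> B" for V
      using that C(1) topological_basis_open[OF E(2)] openin_chart_preimage by (fastforce simp: B_def)
    fix W p assume "openin (atlas_topology A) W \<and> p \<in> W"
    then have W: "openin (atlas_topology A) W" "p \<in> W" by auto
    then have "p \<in> carrier A" using openin_atlas_topology[OF atlas] by blast
    then obtain c where c: "c \<in> C" "c \<in> A" "p \<in> cdom c" using C by blast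
    have "open (cmap c ` (W \<inter> cdom c))" "cmap c p \<in> cmap c ` (W \<inter> cdom c)"
      using W c open_cmap_openin by auto
    then obtain U where U: "U \<in> E" "cmap c p \<in> U" "U \<subseteq> cmap c ` (W \<inter> cdom c)"
      using topological_basisE[OF E(2)] by metis
    have "{p \<in> cdom c. cmap c p \<in> U} \<subseteq> W"
      using U(3) inj_cmap[OF c(2)] by (auto simp: inj_on_def)
    then show "\<exists>V\<in>B. p \<in> V \<and> V \<subseteq> W"
      using c U(1,2) by (intro bexI[of _ "{p \<in> cdom c. cmap c p \<in> U}"]) (auto simp: B_def)
  qed
qed


section \<open>The tangent bundle as a manifold\<close>

context atlas
begin

abbreviation TC :: "('a, 'e) chart \<Rightarrow> (('a, 'e) tpoint, 'e \<times> 'e) chart"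
  where "TC \<equiv> tangent_chart A"

lemma mem_cdom_TC [simp]: "(p, v) \<in> cdom (TC c) \<longleftrightarrow> p \<in> cdom c \<and> v \<in> tangent_space A p"
  by (simp add: tangent_chart_def)

lemma cmap_TC [simp]: "cmap (TC c) (p, v) = (cmap c p, v c)"
  by (simp add: tangent_chart_def)

lemma mem_carrier_TB: "(p, v) \<in> carrier (tangent_bundle A) \<longleftrightarrow> p \<in> carrier A \<and> v \<in> tangent_space A p"
  by (auto simp: carrier_def tangent_bundle_def)

lemma cmap_TC_image:
  assumes "c \<in> A" "D \<subseteq> cdom c"
  shows "cmap (TC c) ` {(p, v). p \<in> D \<and> v \<in> tangent_space A p} = (cmap c ` D) \<times> UNIV"
proof -
  have "(cmap c p, \<xi>) \<in> cmap (TC c) ` {(p, v). p \<in> D \<and> v \<in> tangent_space A p}" if "p \<in> D" for p \<xi>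
    by (rule image_eqI[of _ _ "(p, coord_field A c \<xi> p)"]) (use assms that in auto)
  then show ?thesis by auto
qed

lemma inj_cmap_TC: "c \<in> A \<Longrightarrow> inj_on (cmap (TC c)) (cdom (TC c))"
proof (rule inj_onI, clarsimp)
  fix p u q v
  assume c: "c \<in> A" and pq: "p \<in> cdom c" "q \<in> cdom c" "cmap c p = cmap c q"
    and uv: "u \<in> tangent_space A p" "v \<in> tangent_space A q" "u c = v c"
  have "p = q" using inj_onD[OF inj_cmap[OF c] pq(3)] pq by simp
  then show "p = q \<and> u = v" using tangent_eqI[of u p v c] uv c pq(1) by simp
qed

lemma cinv_TC:
  assumes "c \<in> A" "x \<in> cmap c ` cdom c"
  shows "cinv (TC c) (x, y) = (cinv c x, coord_field A c y (cinv c x))"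
proof -
  let ?z = "(cinv c x, coord_field A c y (cinv c x))"
  have z: "?z \<in> cdom (TC c)" "(x, y) = cmap (TC c) ?z" using assms by auto
  show ?thesis unfolding z(2) cinv_def[of "TC c"] by (rule inv_into_f_f[OF inj_cmap_TC[OF assms(1)] z(1)])
qed

lemma cdom_TC_Int:
  "cdom (TC c) \<inter> cdom (TC d) = {(p, v). p \<in> cdom c \<inter> cdom d \<and> v \<in> tangent_space A p}"
  by auto

lemma cdom_TC: "cdom (TC c) = {(p, v). p \<in> cdom c \<and> v \<in> tangent_space A p}"
  by auto

lemma chg_TC:
  assumes "c \<in> A" "d \<in> A" "x \<in> cmap c ` (cdom c \<inter> cdom d)"
  shows "(cmap (TC d) \<circ> cinv (TC c)) (x, y) = (chg c d x, dchg c d x y)"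
  using assms by (auto simp: cinv_TC coord_field_def)

lemma smooth_atlas_tangent_bundle: "smooth_atlas (tangent_bundle A)"
proof -
  have 1: "open (cmap (TC c) ` cdom (TC c))" if c: "c \<in> A" for c
    unfolding cdom_TC using cmap_TC_image[OF c subset_refl] open_cmap[OF c] by (simp add: open_Times)
  have 2: "open (cmap (TC c) ` (cdom (TC c) \<inter> cdom (TC d))) \<and>
      smooth_on (cmap (TC c) ` (cdom (TC c) \<inter> cdom (TC d))) (cmap (TC d) \<circ> cinv (TC c))"
    if c: "c \<in> A" and d: "d \<in> A" for c d
  proof
    let ?S = "cmap c ` (cdom c \<inter> cdom d)"
    have S: "cmap (TC c) ` (cdom (TC c) \<inter> cdom (TC d)) = ?S \<times> (UNIV :: 'e set)"
      unfolding cdom_TC_Int by (rule cmap_TC_image[OF c]) auto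
    show open_S: "open (cmap (TC c) ` (cdom (TC c) \<inter> cdom (TC d)))"
      unfolding S using open_cmap_Int[OF c d] by (simp add: open_Times)
    note op = open_S[unfolded S]
    note fst = smooth_on_compose_fst[OF open_cmap_Int[OF c d], where 'c='e]
    have "smooth_on (?S \<times> (UNIV :: 'e set)) (\<lambda>z. (chg c d (fst z), dchg c d (fst z) (snd z)))"
    proof (rule smooth_on_Pair[OF op fst[OF smooth_chg[OF c d]]])
      show "smooth_on (?S \<times> (UNIV :: 'e set)) (\<lambda>z. dchg c d (fst z) (snd z))"
      proof (rule smooth_on_linear_family[OF op _ _ smooth_on_snd[OF op]])
        show "linear (dchg c d (fst z))" if "z \<in> ?S \<times> (UNIV :: 'e set)" for z
          using that linear_dchg[OF c d] by auto
        show "smooth_on (?S \<times> (UNIV :: 'e set)) (\<lambda>z. dchg c d (fst z) b)" for b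
          by (rule fst[OF smooth_on_frechet_derivative[OF smooth_chg[OF c d]]])
      qed
    qed
    then show "smooth_on (cmap (TC c) ` (cdom (TC c) \<inter> cdom (TC d))) (cmap (TC d) \<circ> cinv (TC c))"
      unfolding S by (subst smooth_on_cong[OF op, where g="\<lambda>z. (chg c d (fst z), dchg c d (fst z) (snd z))"])
        (use chg_TC[OF c d] in auto)
  qed
  show ?thesis
    unfolding smooth_atlas_def tangent_bundle_def using 1 2 inj_cmap_TC by blast
qed

text \<open>The derivative of a change of induced coordinates. The second derivative of the change of base
  coordinates in it is what the inhomogeneous term in the transformation law of the Christoffel
  symbols has to cancel.\<close>
lemma dchg_TC:
  assumes "c \<in> A" "d \<in> A" "p \<in> cdom c" "p \<in> cdom d"
  shows "frechet_derivative (cmap (TC d) \<circ> cinv (TC c)) (at (cmap c p, \<eta>)) (a, b) =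
    (dchg c d (cmap c p) a,
     frechet_derivative (\<lambda>x. dchg c d x \<eta>) (at (cmap c p)) a + dchg c d (cmap c p) b)"
proof -
  let ?S = "cmap c ` (cdom c \<inter> cdom d)" and ?x = "cmap c p"
  note op = open_cmap_Int[OF assms(1,2)] and sm = smooth_chg[OF assms(1,2)]
  have x: "?x \<in> ?S" using assms by auto
  have lin: "linear (dchg c d x)" if "x \<in> ?S" for x using that linear_dchg[OF assms(1,2)] by auto
  have "(fst has_derivative fst) (at (?x, \<eta>))" by (auto intro!: derivative_eq_intros)
  from has_derivative_compose[OF this, of "chg c d" "dchg c d ?x"]
  have 1: "((\<lambda>z. chg c d (fst z)) has_derivative (\<lambda>z. dchg c d ?x (fst z))) (at (?x, \<eta>))"
    using smooth_on_has_derivative[OF sm x] by simp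
  have 2: "((\<lambda>(x, y). dchg c d x y) has_derivative
      (\<lambda>(a, b). frechet_derivative (\<lambda>x. dchg c d x \<eta>) (at ?x) a + dchg c d ?x b)) (at (?x, \<eta>))"
    by (rule has_derivative_linear_family[OF op x], erule lin)
      (rule smooth_on_has_derivative[OF smooth_on_frechet_derivative[OF sm] x])
  have "((cmap (TC d) \<circ> cinv (TC c)) has_derivative (\<lambda>z. (dchg c d ?x (fst z),
      (\<lambda>(a, b). frechet_derivative (\<lambda>x. dchg c d x \<eta>) (at ?x) a + dchg c d ?x b) z))) (at (?x, \<eta>))"
    by (rule has_derivative_transform_within_open[OF has_derivative_Pair[OF 1 2], of "?S \<times> UNIV"])
      (use chg_TC[OF assms(1,2)] op x in \<open>auto simp: open_Times\<close>)
  then have "frechet_derivative (cmap (TC d) \<circ> cinv (TC c)) (at (?x, \<eta>)) = (\<lambda>z. (dchg c d ?x (fst z),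
      (\<lambda>(a, b). frechet_derivative (\<lambda>x. dchg c d x \<eta>) (at ?x) a + dchg c d ?x b) z))"
    by (rule frechet_derivative_at[symmetric])
  then show ?thesis by simp
qed

end

context atlas
begin

interpretation TB: atlas "tangent_bundle A"
  by unfold_locales (rule smooth_atlas_tangent_bundle)

lemma openin_TB_over:
  assumes "openin (atlas_topology A) W"
  shows "openin (atlas_topology (tangent_bundle A)) {(p, v). p \<in> W \<and> v \<in> tangent_space A p}"
  unfolding openin_atlas_topology[OF smooth_atlas_tangent_bundle]
proof (intro conjI ballI)
  have W: "W \<subseteq> carrier A" "\<And>c. c \<in> A \<Longrightarrow> open (cmap c ` (W \<inter> cdom c))"
    using assms by (auto simp: openin_atlas_topology[OF atlas])
  show "{(p, v). p \<in> W \<and> v \<in> tangent_space A p} \<subseteq> carrier (tangent_bundle A)"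
    using W(1) by (auto simp: mem_carrier_TB)
  fix C assume "C \<in> tangent_bundle A"
  then obtain c where c: "c \<in> A" "C = TC c" by (auto simp: tangent_bundle_def)
  have "{(p, v). p \<in> W \<and> v \<in> tangent_space A p} \<inter> cdom C =
      {(p, v). p \<in> W \<inter> cdom c \<and> v \<in> tangent_space A p}" using c by auto
  then show "open (cmap C ` ({(p, v). p \<in> W \<and> v \<in> tangent_space A p} \<inter> cdom C))"
    using cmap_TC_image[OF c(1), of "W \<inter> cdom c"] W(2)[OF c(1)] c by (simp add: open_Times)
qed

text \<open>Points of the bundle over different base points are separated by sets of the base, points of
  one fibre by sets of coordinates.\<close>
lemma Hausdorff_tangent_bundle:
  assumes "Hausdorff_space (atlas_topology A)"
  shows "Hausdorff_space (atlas_topology (tangent_bundle A))"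
  unfolding Hausdorff_space_def TB.topspace_atlas
proof (intro allI impI)
  fix z w :: "('a, 'e) tpoint"
  assume zw: "z \<in> carrier (tangent_bundle A) \<and> w \<in> carrier (tangent_bundle A) \<and> z \<noteq> w"
  obtain p u q v where [simp]: "z = (p, u)" "w = (q, v)" by fastforce
  have pq: "p \<in> carrier A" "u \<in> tangent_space A p" "q \<in> carrier A" "v \<in> tangent_space A q"
    using zw by (auto simp: mem_carrier_TB)
  let ?X = "atlas_topology (tangent_bundle A)"
  show "\<exists>U V. openin ?X U \<and> openin ?X V \<and> z \<in> U \<and> w \<in> V \<and> disjnt U V"
  proof (cases "p = q")
    case False
    then obtain U V where UV: "openin (atlas_topology A) U" "openin (atlas_topology A) V"
      "p \<in> U" "q \<in> V" "disjnt U V"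
      using assms pq unfolding Hausdorff_space_def topspace_atlas by metis
    show ?thesis
      using openin_TB_over[OF UV(1)] openin_TB_over[OF UV(2)] UV(3-5) pq
      by (intro exI[of _ "{(p, v). p \<in> U \<and> v \<in> tangent_space A p}"]
          exI[of _ "{(p, v). p \<in> V \<and> v \<in> tangent_space A p}"]) (auto simp: disjnt_def)
  next
    case True
    obtain c where c: "c \<in> A" "p \<in> cdom c" using carrier_chart[OF pq(1)] by blast
    have "u c \<noteq> v c" using tangent_eqI[OF pq(2) _ c] pq(4) zw True by auto
    then obtain U V where UV: "open U" "open V" "u c \<in> U" "v c \<in> V" "U \<inter> V = {}"
      using hausdorff by metis
    have C: "TC c \<in> tangent_bundle A" using c by (simp add: tangent_bundle_def)
    have op: "open ((UNIV :: 'e set) \<times> U)" "open ((UNIV :: 'e set) \<times> V)" using UV by (auto simp: open_Times)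
    show ?thesis
      using TB.openin_chart_preimage[OF C op(1)] TB.openin_chart_preimage[OF C op(2)] UV(3-5) pq c True
      by (intro exI[of _ "{z \<in> cdom (TC c). cmap (TC c) z \<in> UNIV \<times> U}"]
          exI[of _ "{z \<in> cdom (TC c). cmap (TC c) z \<in> UNIV \<times> V}"]) (auto simp: disjnt_def)
  qed
qed

lemma second_countable_tangent_bundle:
  assumes "second_countable (atlas_topology A)"
  shows "second_countable (atlas_topology (tangent_bundle A))"
proof -
  obtain C where C: "C \<subseteq> A" "countable C" "carrier A = \<Union>(cdom ` C)"
    using assms unfolding second_countable_iff_countable_cover by blast
  have "carrier (tangent_bundle A) = \<Union>(cdom ` TC ` C)"
    using mem_carrier_TB unfolding C(3) by (auto simp: cdom_TC)
  then show ?thesis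
    unfolding TB.second_countable_iff_countable_cover
    by (intro exI[of _ "TC ` C"]) (use C in \<open>auto simp: tangent_bundle_def\<close>)
qed

end

lemma smooth_manifold_tangent_bundle:
  assumes "smooth_manifold A"
  shows "smooth_manifold (tangent_bundle A)"
proof -
  interpret atlas A using assms by unfold_locales (simp add: smooth_manifold_def)
  show ?thesis
    using assms smooth_atlas_tangent_bundle Hausdorff_tangent_bundle second_countable_tangent_bundle
    by (simp add: smooth_manifold_def)
qed


section \<open>Locality of linear connections and the Christoffel symbols\<close>

context atlas
begin

lemma smooth_fun_onI:
  assumes W: "openin (atlas_topology A) W" and c: "c \<in> A" "W \<subseteq> cdom c"
    and F: "smooth_on (cmap c ` W) (F \<circ> cinv c)"
  shows "smooth_fun_on A W F"
  unfolding smooth_fun_on_def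
proof
  fix d assume d: "d \<in> A"
  have W_c: "W \<inter> cdom c = W" using c by blast
  let ?S = "cmap d ` (W \<inter> cdom d)"
  have op: "open ?S" by (rule open_cmap_openin[OF W d])
  have "smooth_on ?S (chg d c)"
    by (rule smooth_on_subset[OF smooth_chg[OF d c(1)]]) (use c in auto)
  moreover have "chg d c ` ?S \<subseteq> cmap c ` W" using d by auto
  ultimately have "smooth_on ?S (\<lambda>x. (F \<circ> cinv c) (chg d c x))"
    by (intro smooth_on_compose[OF op open_cmap_openin[OF W c(1), unfolded W_c] _ _ F])
  then show "smooth_on ?S (F \<circ> cinv d)"
    by (subst smooth_on_cong[OF op, where g="\<lambda>x. (F \<circ> cinv c) (chg d c x)"]) (use c d in auto)
qed

lemma vector_field_add:
  assumes "openin (atlas_topology A) W" "vector_field_on A W X" "vector_field_on A W Y"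
  shows "vector_field_on A W (\<lambda>q. X q + Y q)"
  using assms by (auto simp: vector_field_on_def intro!: smooth_on_add open_cmap_openin)

lemma vector_field_diff:
  assumes "openin (atlas_topology A) W" "vector_field_on A W X" "vector_field_on A W Y"
  shows "vector_field_on A W (\<lambda>q. X q - Y q)"
  using assms by (auto simp: vector_field_on_def intro!: smooth_on_diff open_cmap_openin)

lemma vector_field_scaleR:
  assumes "openin (atlas_topology A) W" "smooth_fun_on A W f" "vector_field_on A W X"
  shows "vector_field_on A W (\<lambda>q. f q *\<^sub>R X q)"
  using assms by (auto simp: vector_field_on_def smooth_fun_on_def o_def intro!: smooth_on_scaleR open_cmap_openin)

lemma vector_field_zero: "vector_field_on A W (\<lambda>q. 0)"
  by (auto simp: vector_field_on_def smooth_on_const)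

lemma vector_field_sum:
  assumes "openin (atlas_topology A) W" "\<And>i. i \<in> I \<Longrightarrow> vector_field_on A W (X i)"
  shows "vector_field_on A W (\<lambda>q. \<Sum>i\<in>I. X i q)"
  using assms(2)
  by (induction I rule: infinite_finite_induct) (auto intro: vector_field_zero vector_field_add[OF assms(1)])

lemma vector_field_coord_field_openin:
  assumes "openin (atlas_topology A) W" "c \<in> A" "W \<subseteq> cdom c"
  shows "vector_field_on A W (coord_field A c \<xi>)"
  by (rule vector_field_coord_field[OF assms(2,3) open_cmap_openin[OF assms(1)]])

text \<open>The chain rule connects \<open>c\<close> with the chart that \<open>dir_deriv\<close> chooses.\<close>
lemma dir_deriv_chart:
  assumes c: "c \<in> A" "p \<in> cdom c" and u: "u \<in> tangent_space A p"
    and F: "((F \<circ> cinv c) has_derivative D) (at (cmap c p))"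
  shows "dir_deriv A p u F = D (u c)"
proof -
  define e where "e = (SOME c. c \<in> A \<and> p \<in> cdom c)"
  have e: "e \<in> A" "p \<in> cdom e"
    using someI[of "\<lambda>c. c \<in> A \<and> p \<in> cdom c" c] c unfolding e_def by auto
  have "((F \<circ> cinv c) has_derivative D) (at (chg e c (cmap e p)))" using F e by simp
  from has_derivative_compose[OF chg_has_derivative[OF e(1) c(1) e(2) c(2)] this]
  have "((F \<circ> cinv e) has_derivative (\<lambda>\<xi>. D (dchg e c (cmap e p) \<xi>))) (at (cmap e p))"
    by (rule has_derivative_transform_within_open[OF _ open_cmap_Int[OF e(1) c(1)]]) (use c e in auto)
  then have "frechet_derivative (F \<circ> cinv e) (at (cmap e p)) = (\<lambda>\<xi>. D (dchg e c (cmap e p) \<xi>))"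
    by (rule frechet_derivative_at[symmetric])
  then show ?thesis
    using tangent_space_change[OF u e(1) c(1) e(2) c(2)] by (simp add: dir_deriv_def Let_def e_def[symmetric])
qed

end

locale connection = atlas A for A :: "('a, 'e::euclidean_space) chart set" +
  fixes nabla :: "('a \<Rightarrow> ('a, 'e) tvec) \<Rightarrow> ('a \<Rightarrow> ('a, 'e) tvec) \<Rightarrow> 'a \<Rightarrow> ('a, 'e) tvec"
  assumes linear_connection: "linear_connection A nabla"
begin

context
  fixes W X Y
  assumes W: "openin (atlas_topology A) W"
    and X: "vector_field_on A W X" and Y: "vector_field_on A W Y"
begin

lemma nabla_field: "vector_field_on A W (nabla X Y)"
  using linear_connection W X Y unfolding linear_connection_def by blast

lemma nabla_add_left:
  "vector_field_on A W Z \<Longrightarrow> p \<in> W \<Longrightarrow> nabla (\<lambda>q. X q + Z q) Y p = nabla X Y p + nabla Z Y p"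
  using linear_connection W X Y unfolding linear_connection_def by blast

lemma nabla_add_right:
  "vector_field_on A W Z \<Longrightarrow> p \<in> W \<Longrightarrow> nabla X (\<lambda>q. Y q + Z q) p = nabla X Y p + nabla X Z p"
  using linear_connection W X Y unfolding linear_connection_def by blast

lemma nabla_scaleR_left:
  "smooth_fun_on A W f \<Longrightarrow> p \<in> W \<Longrightarrow> nabla (\<lambda>q. f q *\<^sub>R X q) Y p = f p *\<^sub>R nabla X Y p"
  using linear_connection W X Y unfolding linear_connection_def by blast

lemma nabla_scaleR_right:
  "smooth_fun_on A W f \<Longrightarrow> p \<in> W \<Longrightarrow>
    nabla X (\<lambda>q. f q *\<^sub>R Y q) p = dir_deriv A p (X p) f *\<^sub>R Y p + f p *\<^sub>R nabla X Y p"
  using linear_connection W X Y unfolding linear_connection_def by blast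

end

lemma smooth_fun_on_indicator:
  assumes "openin (atlas_topology A) W"
  shows "smooth_fun_on A W (\<lambda>q. if q \<in> W then 0 else 1)"
  unfolding smooth_fun_on_def
proof
  fix c assume c: "c \<in> A"
  show "smooth_on (cmap c ` (W \<inter> cdom c)) ((\<lambda>q. if q \<in> W then 0 else 1) \<circ> cinv c)"
    by (subst smooth_on_cong[OF open_cmap_openin[OF assms c], where g="\<lambda>x. 0"])
      (use c in \<open>auto intro: smooth_on_const\<close>)
qed

text \<open>A field that vanishes on \<open>W\<close> is its own product with the function that is \<open>0\<close> on \<open>W\<close> and
  \<open>1\<close> elsewhere; the Leibniz rule and linearity over functions then make its contribution vanish.\<close>
lemma nabla_cong:
  assumes W: "openin (atlas_topology A) W" and p: "p \<in> W"
    and X: "vector_field_on A W X" "vector_field_on A W X'" "\<And>q. q \<in> W \<Longrightarrow> X q = X' q"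
    and Y: "vector_field_on A W Y" "vector_field_on A W Y'" "\<And>q. q \<in> W \<Longrightarrow> Y q = Y' q"
  shows "nabla X Y p = nabla X' Y' p"
proof -
  let ?f = "\<lambda>q. if q \<in> W then 0 else 1 :: real"
  let ?U = "\<lambda>q. X' q - X q" and ?Z = "\<lambda>q. Y' q - Y q"
  note U = vector_field_diff[OF W X(2,1)] and Z = vector_field_diff[OF W Y(2,1)]
  note f = smooth_fun_on_indicator[OF W]
  have "(\<lambda>q. ?f q *\<^sub>R ?U q) = ?U" "(\<lambda>q. ?f q *\<^sub>R ?Z q) = ?Z"
    using X(3) Y(3) by auto
  then have "nabla ?U Y p = 0" "nabla X' ?Z p = 0"
    using nabla_scaleR_left[OF W U Y(1) f p] nabla_scaleR_right[OF W X(2) Z f p] p Y(3) by simp_all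
  then show ?thesis
    using nabla_add_left[OF W X(1) Y(1) U p] nabla_add_right[OF W X(2) Y(1) Z p] by simp
qed

lemma nabla_sum_left:
  assumes W: "openin (atlas_topology A) W" and p: "p \<in> W" and Y: "vector_field_on A W Y"
    and X: "\<And>i. i \<in> I \<Longrightarrow> vector_field_on A W (X i)" and f: "\<And>i. i \<in> I \<Longrightarrow> smooth_fun_on A W (f i)"
    and I: "finite I"
  shows "nabla (\<lambda>q. \<Sum>i\<in>I. f i q *\<^sub>R X i q) Y p = (\<Sum>i\<in>I. f i p *\<^sub>R nabla (X i) Y p)"
  using I X f
proof (induction I)
  case empty
  have "nabla (\<lambda>q. 0) Y p = 0"
    using nabla_add_left[OF W vector_field_zero Y vector_field_zero p] by simp
  then show ?case by (simp only: sum.empty)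
next
  case (insert i I)
  have IH: "nabla (\<lambda>q. \<Sum>i\<in>I. f i q *\<^sub>R X i q) Y p = (\<Sum>i\<in>I. f i p *\<^sub>R nabla (X i) Y p)"
    by (rule insert.IH) (blast intro: insert.prems)+
  have "nabla (\<lambda>q. f i q *\<^sub>R X i q + (\<Sum>i\<in>I. f i q *\<^sub>R X i q)) Y p =
      nabla (\<lambda>q. f i q *\<^sub>R X i q) Y p + nabla (\<lambda>q. \<Sum>i\<in>I. f i q *\<^sub>R X i q) Y p"
    using insert.prems by (intro nabla_add_left[OF W _ Y _ p] vector_field_sum vector_field_scaleR W) auto
  also have "\<dots> = f i p *\<^sub>R nabla (X i) Y p + (\<Sum>i\<in>I. f i p *\<^sub>R nabla (X i) Y p)"
    unfolding IH nabla_scaleR_left[OF W insert.prems(1)[OF insertI1] Y insert.prems(2)[OF insertI1] p] ..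
  finally show ?case by (simp only: sum.insert[OF insert.hyps])
qed

lemma nabla_sum_right:
  assumes W: "openin (atlas_topology A) W" and p: "p \<in> W" and X: "vector_field_on A W X"
    and Y: "\<And>i. i \<in> I \<Longrightarrow> vector_field_on A W (Y i)" and f: "\<And>i. i \<in> I \<Longrightarrow> smooth_fun_on A W (f i)"
    and I: "finite I"
  shows "nabla X (\<lambda>q. \<Sum>i\<in>I. f i q *\<^sub>R Y i q) p =
    (\<Sum>i\<in>I. dir_deriv A p (X p) (f i) *\<^sub>R Y i p) + (\<Sum>i\<in>I. f i p *\<^sub>R nabla X (Y i) p)"
  using I Y f
proof (induction I)
  case empty
  have "nabla X (\<lambda>q. 0) p = 0"
    using nabla_add_right[OF W X vector_field_zero vector_field_zero p] by simp
  then show ?case by (simp only: sum.empty add_0)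
next
  case (insert i I)
  have IH: "nabla X (\<lambda>q. \<Sum>i\<in>I. f i q *\<^sub>R Y i q) p =
      (\<Sum>i\<in>I. dir_deriv A p (X p) (f i) *\<^sub>R Y i p) + (\<Sum>i\<in>I. f i p *\<^sub>R nabla X (Y i) p)"
    by (rule insert.IH) (blast intro: insert.prems)+
  have "nabla X (\<lambda>q. f i q *\<^sub>R Y i q + (\<Sum>i\<in>I. f i q *\<^sub>R Y i q)) p =
      nabla X (\<lambda>q. f i q *\<^sub>R Y i q) p + nabla X (\<lambda>q. \<Sum>i\<in>I. f i q *\<^sub>R Y i q) p"
    using insert.prems by (intro nabla_add_right[OF W X _ _ p] vector_field_sum vector_field_scaleR W) auto
  also have "\<dots> = (dir_deriv A p (X p) (f i) *\<^sub>R Y i p + f i p *\<^sub>R nabla X (Y i) p) +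
      ((\<Sum>i\<in>I. dir_deriv A p (X p) (f i) *\<^sub>R Y i p) + (\<Sum>i\<in>I. f i p *\<^sub>R nabla X (Y i) p))"
    unfolding IH nabla_scaleR_right[OF W X insert.prems(1)[OF insertI1] insert.prems(2)[OF insertI1] p] ..
  finally show ?case by (simp only: sum.insert[OF insert.hyps] ac_simps)
qed

lemma openin_cdom_Int: "c \<in> A \<Longrightarrow> d \<in> A \<Longrightarrow> openin (atlas_topology A) (cdom c \<inter> cdom d)"
  by (intro openin_Int openin_cdom)

lemma coord_field_expansion:
  assumes "c \<in> A" "d \<in> A" "p \<in> cdom c" "p \<in> cdom d"
  shows "coord_field A c \<xi> p = (\<Sum>b\<in>Basis. (dchg c d (cmap c p) \<xi> \<bullet> b) *\<^sub>R coord_field A d b p)"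
proof -
  have "coord_field A c \<xi> p = coord_field A d (coord_field A c \<xi> p d) p"
    using assms by (simp add: coord_field_self)
  also have "coord_field A c \<xi> p d = dchg c d (cmap c p) \<xi>"
    using assms by (simp add: coord_field_def)
  finally show ?thesis
    using linear_Basis_expansion[OF linear_coord_field[OF assms(2,4)], of "dchg c d (cmap c p) \<xi>"] by simp
qed

lemma coord_coefficient:
  assumes c: "c \<in> A" and d: "d \<in> A"
  shows "smooth_on (cmap c ` (cdom c \<inter> cdom d)) ((\<lambda>q. dchg c d (cmap c q) \<xi> \<bullet> b) \<circ> cinv c)"
    and "smooth_fun_on A (cdom c \<inter> cdom d) (\<lambda>q. dchg c d (cmap c q) \<xi> \<bullet> b)"
proof -
  note sm = smooth_on_bounded_linear_compose[OF bounded_linear_inner_left open_cmap_Int[OF c d]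
      smooth_on_frechet_derivative[OF smooth_chg[OF c d]]]
  show *: "smooth_on (cmap c ` (cdom c \<inter> cdom d)) ((\<lambda>q. dchg c d (cmap c q) \<xi> \<bullet> b) \<circ> cinv c)"
    by (subst smooth_on_cong[OF open_cmap_Int[OF c d], where g="\<lambda>x. dchg c d x \<xi> \<bullet> b"])
      (use c sm in auto)
  show "smooth_fun_on A (cdom c \<inter> cdom d) (\<lambda>q. dchg c d (cmap c q) \<xi> \<bullet> b)"
    by (rule smooth_fun_onI[OF openin_cdom_Int[OF c d] c _ *]) auto
qed

text \<open>The next two lemmas are where locality is used: the expansion of one coordinate field in the
  coordinate fields of another chart only holds on the intersection of the two domains.\<close>
lemma nabla_coord_left:
  assumes "c \<in> A" "d \<in> A" "p \<in> cdom c" "p \<in> cdom d" "vector_field_on A (cdom c \<inter> cdom d) Y"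
  shows "nabla (coord_field A c \<xi>) Y p =
    (\<Sum>b\<in>Basis. (dchg c d (cmap c p) \<xi> \<bullet> b) *\<^sub>R nabla (coord_field A d b) Y p)"
proof -
  let ?W = "cdom c \<inter> cdom d" and ?f = "\<lambda>b q. dchg c d (cmap c q) \<xi> \<bullet> b"
  note W = openin_cdom_Int[OF assms(1,2)]
  have vf: "vector_field_on A ?W (coord_field A c \<xi>)" "vector_field_on A ?W (coord_field A d b)" for b
    using assms by (auto intro: vector_field_coord_field_openin[OF W])
  have "nabla (coord_field A c \<xi>) Y p = nabla (\<lambda>q. \<Sum>b\<in>Basis. ?f b q *\<^sub>R coord_field A d b q) Y p"
    by (rule nabla_cong[OF W])
      (use assms vf in \<open>auto intro!: vector_field_sum vector_field_scaleR W coord_coefficient(2)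
        coord_field_expansion\<close>)
  also have "\<dots> = (\<Sum>b\<in>Basis. ?f b p *\<^sub>R nabla (coord_field A d b) Y p)"
    by (rule nabla_sum_left[OF W]) (use assms vf in \<open>auto intro: coord_coefficient(2)\<close>)
  finally show ?thesis .
qed

lemma nabla_coord_right:
  assumes "c \<in> A" "d \<in> A" "p \<in> cdom c" "p \<in> cdom d" and X: "vector_field_on A (cdom c \<inter> cdom d) X"
  shows "nabla X (coord_field A c \<eta>) p =
    coord_field A d (frechet_derivative (\<lambda>x. dchg c d x \<eta>) (at (cmap c p)) (X p c)) p +
    (\<Sum>b\<in>Basis. (dchg c d (cmap c p) \<eta> \<bullet> b) *\<^sub>R nabla X (coord_field A d b) p)"
proof -
  let ?W = "cdom c \<inter> cdom d" and ?f = "\<lambda>b q. dchg c d (cmap c q) \<eta> \<bullet> b"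
  let ?D = "frechet_derivative (\<lambda>x. dchg c d x \<eta>) (at (cmap c p))"
  note W = openin_cdom_Int[OF assms(1,2)]
  have vf: "vector_field_on A ?W (coord_field A c \<eta>)" "vector_field_on A ?W (coord_field A d b)" for b
    using assms by (auto intro: vector_field_coord_field_openin[OF W])
  have Xp: "X p \<in> tangent_space A p" using X assms by (auto simp: vector_field_on_def)
  have dir: "dir_deriv A p (X p) (?f b) = ?D (X p c) \<bullet> b" for b
  proof (rule dir_deriv_chart[OF assms(1,3) Xp])
    have "((\<lambda>x. dchg c d x \<eta>) has_derivative ?D) (at (cmap c p))"
      by (rule smooth_on_has_derivative[OF smooth_on_frechet_derivative[OF smooth_chg[OF assms(1,2)]]])
        (use assms in auto)
    then have "((\<lambda>x. dchg c d x \<eta> \<bullet> b) has_derivative (\<lambda>\<xi>. ?D \<xi> \<bullet> b)) (at (cmap c p))"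
      by (rule has_derivative_inner_left)
    then show "((?f b \<circ> cinv c) has_derivative (\<lambda>\<xi>. ?D \<xi> \<bullet> b)) (at (cmap c p))"
      by (rule has_derivative_transform_within_open[OF _ open_cmap_Int[OF assms(1,2)]]) (use assms in auto)
  qed
  have "nabla X (coord_field A c \<eta>) p = nabla X (\<lambda>q. \<Sum>b\<in>Basis. ?f b q *\<^sub>R coord_field A d b q) p"
    by (rule nabla_cong[OF W])
      (use assms vf in \<open>auto intro!: vector_field_sum vector_field_scaleR W coord_coefficient(2)
        coord_field_expansion\<close>)
  also have "\<dots> = (\<Sum>b\<in>Basis. dir_deriv A p (X p) (?f b) *\<^sub>R coord_field A d b p) +
      (\<Sum>b\<in>Basis. ?f b p *\<^sub>R nabla X (coord_field A d b) p)"
    by (rule nabla_sum_right[OF W]) (use assms vf in \<open>auto intro: coord_coefficient(2)\<close>)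
  also have "(\<Sum>b\<in>Basis. dir_deriv A p (X p) (?f b) *\<^sub>R coord_field A d b p) = coord_field A d (?D (X p c)) p"
    unfolding dir by (rule linear_Basis_expansion[OF linear_coord_field[OF assms(2,4)], symmetric])
  finally show ?thesis .
qed

lemma second_derivative_chg_self:
  assumes "c \<in> A" "p \<in> cdom c"
  shows "frechet_derivative (\<lambda>x. dchg c c x \<eta>) (at (cmap c p)) \<xi> = 0"
proof -
  have "frechet_derivative (\<lambda>x. dchg c c x \<eta>) (at (cmap c p)) = frechet_derivative (\<lambda>x. \<eta>) (at (cmap c p))"
    by (rule frechet_derivative_cong_open[OF open_cmap[OF assms(1)]]) (use assms in auto)
  then show ?thesis by simp
qed

text \<open>For \<open>c = d\<close> the two expansions express linearity over the reals; the second derivative of the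
  trivial change of chart is \<open>0\<close>.\<close>
lemma nabla_coord_left_linear:
  assumes "d \<in> A" "p \<in> cdom d" "vector_field_on A (cdom d) Y"
  shows "nabla (coord_field A d \<xi>) Y p = (\<Sum>b\<in>Basis. (\<xi> \<bullet> b) *\<^sub>R nabla (coord_field A d b) Y p)"
  using nabla_coord_left[of d d p Y \<xi>] assms by simp

lemma nabla_coord_right_linear:
  assumes "d \<in> A" "p \<in> cdom d" "vector_field_on A (cdom d) X"
  shows "nabla X (coord_field A d \<eta>) p = (\<Sum>b\<in>Basis. (\<eta> \<bullet> b) *\<^sub>R nabla X (coord_field A d b) p)"
  using nabla_coord_right[of d d p X \<eta>] assms
  by (simp add: second_derivative_chg_self linear_0[OF linear_coord_field])

lemma linear_inner_sum:
  fixes v :: "'e \<Rightarrow> 'b::real_vector"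
  shows "linear (\<lambda>x. \<Sum>b\<in>Basis. (x \<bullet> b) *\<^sub>R v b)"
  by (rule linearI) (simp_all add: inner_add_left scaleR_add_left sum.distrib scaleR_sum_right)

abbreviation Gamma :: "('a, 'e) chart \<Rightarrow> 'a \<Rightarrow> 'e \<Rightarrow> 'e \<Rightarrow> 'e"
  where "Gamma \<equiv> christoffel A nabla"

lemma linear_component: "linear (\<lambda>v. v c)"
  by (rule linearI) simp_all

context
  fixes c p assumes c: "c \<in> A" and p: "p \<in> cdom c"
begin

lemma vector_field_coord_cdom: "vector_field_on A (cdom c) (coord_field A c \<xi>)"
  by (rule vector_field_coord_field_openin[OF openin_cdom[OF c] c]) simp

lemma linear_christoffel_left: "linear (\<lambda>\<xi>. Gamma c p \<xi> \<eta>)"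
proof -
  have eq: "(\<lambda>\<xi>. Gamma c p \<xi> \<eta>) =
    (\<lambda>v. v c) \<circ> (\<lambda>\<xi>. \<Sum>b\<in>Basis. (\<xi> \<bullet> b) *\<^sub>R nabla (coord_field A c b) (coord_field A c \<eta>) p)"
    by (rule ext, unfold christoffel_def o_def,
        subst nabla_coord_left_linear[OF c p vector_field_coord_cdom], rule refl)
  show ?thesis unfolding eq by (rule linear_compose[OF linear_inner_sum linear_component])
qed

lemma linear_christoffel_right: "linear (\<lambda>\<eta>. Gamma c p \<xi> \<eta>)"
proof -
  have eq: "(\<lambda>\<eta>. Gamma c p \<xi> \<eta>) =
    (\<lambda>v. v c) \<circ> (\<lambda>\<eta>. \<Sum>b\<in>Basis. (\<eta> \<bullet> b) *\<^sub>R nabla (coord_field A c \<xi>) (coord_field A c b) p)"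
    by (rule ext, unfold christoffel_def o_def,
        subst nabla_coord_right_linear[OF c p vector_field_coord_cdom], rule refl)
  show ?thesis unfolding eq by (rule linear_compose[OF linear_inner_sum linear_component])
qed

text \<open>The derivative term is the price of expanding the second coordinate field, whose coefficients
  with respect to the other chart are differentiated by the Leibniz rule. It is the same second
  derivative of the coordinate change as in \<open>dchg_TC\<close>.\<close>
lemma christoffel_change:
  assumes d: "d \<in> A" "p \<in> cdom d"
  shows "Gamma d p (dchg c d (cmap c p) \<xi>) (dchg c d (cmap c p) \<eta>) =
    dchg c d (cmap c p) (Gamma c p \<xi> \<eta>) - frechet_derivative (\<lambda>x. dchg c d x \<eta>) (at (cmap c p)) \<xi>"
proof -
  let ?W = "cdom c \<inter> cdom d" and ?L = "dchg c d (cmap c p)"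
  let ?D = "frechet_derivative (\<lambda>x. dchg c d x \<eta>) (at (cmap c p)) \<xi>"
  let ?w = "nabla (coord_field A c \<xi>) (coord_field A c \<eta>) p"
  note W = openin_cdom_Int[OF c d(1)]
  have vf: "vector_field_on A ?W (coord_field A c \<zeta>)" "vector_field_on A ?W (coord_field A d \<zeta>)" for \<zeta>
    using c d by (auto intro: vector_field_coord_field_openin[OF W])
  have vfd: "vector_field_on A (cdom d) (coord_field A d \<zeta>)" for \<zeta>
    by (rule vector_field_coord_field_openin[OF openin_cdom[OF d(1)] d(1)]) simp
  have w: "?w \<in> tangent_space A p"
    using nabla_field[OF W vf(1) vf(1)] p d by (auto simp: vector_field_on_def)
  have left: "nabla (coord_field A c \<xi>) (coord_field A d \<zeta>) p =
      nabla (coord_field A d (?L \<xi>)) (coord_field A d \<zeta>) p" for \<zeta>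
    by (rule trans[OF nabla_coord_left[OF c d(1) p d(2) vf(2)] nabla_coord_left_linear[OF d vfd, symmetric]])
  have "?w = coord_field A d ?D p + (\<Sum>b\<in>Basis. (?L \<eta> \<bullet> b) *\<^sub>R nabla (coord_field A c \<xi>) (coord_field A d b) p)"
    using nabla_coord_right[OF c d(1) p d(2) vf(1)[of \<xi>], of \<eta>] unfolding coord_field_comp[OF c p] .
  also have "\<dots> = coord_field A d ?D p + nabla (coord_field A d (?L \<xi>)) (coord_field A d (?L \<eta>)) p"
    unfolding left nabla_coord_right_linear[OF d vfd[of "?L \<xi>"], of "?L \<eta>"] ..
  finally have "?w d = ?D + Gamma d p (?L \<xi>) (?L \<eta>)" using d by (simp add: christoffel_def)
  moreover have "?w d = ?L (Gamma c p \<xi> \<eta>)"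
    using tangent_space_change[OF w c d(1) p d(2)] by (simp add: christoffel_def)
  ultimately show ?thesis by (simp add: algebra_simps)
qed

end

lemma smooth_on_christoffel:
  assumes c: "c \<in> A"
  shows "smooth_on (cmap c ` cdom c) (\<lambda>x. Gamma c (cinv c x) \<xi> \<eta>)"
proof -
  have "vector_field_on A (cdom c) (nabla (coord_field A c \<xi>) (coord_field A c \<eta>))"
    by (intro nabla_field openin_cdom vector_field_coord_field_openin c subset_refl)
  then have "smooth_on (cmap c ` (cdom c \<inter> cdom c))
      (\<lambda>x. nabla (coord_field A c \<xi>) (coord_field A c \<eta>) (cinv c x) c)"
    using c unfolding vector_field_on_def by blast
  then show ?thesis unfolding christoffel_def Int_absorb .
qed


section \<open>Horizontal and vertical lifts\<close>

interpretation TB: atlas "tangent_bundle A"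
  by unfold_locales (rule smooth_atlas_tangent_bundle)

lemma TC_in [simp]: "c \<in> A \<Longrightarrow> TC c \<in> tangent_bundle A"
  by (simp add: tangent_bundle_def)

lemma TB_eqI:
  assumes "(p, v) \<in> carrier (tangent_bundle A)"
    and "w \<in> tangent_space (tangent_bundle A) (p, v)" "z \<in> tangent_space (tangent_bundle A) (p, v)"
    and "\<And>c. c \<in> A \<Longrightarrow> p \<in> cdom c \<Longrightarrow> w (TC c) = z (TC c)"
  shows "w = z"
proof -
  obtain c where "c \<in> A" "p \<in> cdom c" using assms(1) carrier_chart by (auto simp: mem_carrier_TB)
  then show ?thesis using TB.tangent_eqI[OF assms(2,3), of "TC c"] assms(1,4) by (auto simp: mem_carrier_TB)
qed

text \<open>The condition on \<open>f\<close> is the transformation rule \<open>dchg_TC\<close> of the components of a tangent vector of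
  the bundle. The vector is built from its components in a single chart; this turns the definite
  descriptions in \<open>hlift\<close> and \<open>vlift\<close> into actual vectors.\<close>
lemma TB_ex1:
  assumes q: "(p, v) \<in> carrier (tangent_bundle A)"
    and f: "\<And>c d. c \<in> A \<Longrightarrow> d \<in> A \<Longrightarrow> p \<in> cdom c \<Longrightarrow> p \<in> cdom d \<Longrightarrow> f d =
      (dchg c d (cmap c p) (fst (f c)),
       frechet_derivative (\<lambda>x. dchg c d x (v c)) (at (cmap c p)) (fst (f c)) + dchg c d (cmap c p) (snd (f c)))"
  shows "\<exists>!w. w \<in> tangent_space (tangent_bundle A) (p, v) \<and> (\<forall>c\<in>A. p \<in> cdom c \<longrightarrow> w (TC c) = f c)"
proof -
  have v: "v \<in> tangent_space A p" using q by (simp add: mem_carrier_TB)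
  obtain c where c: "c \<in> A" "p \<in> cdom c" using q carrier_chart by (auto simp: mem_carrier_TB)
  let ?w = "coord_field (tangent_bundle A) (TC c) (f c) (p, v)"
  have "?w \<in> tangent_space (tangent_bundle A) (p, v)"
    using c v by (intro TB.coord_field_in) auto
  moreover have "?w (TC d) = f d" if d: "d \<in> A" "p \<in> cdom d" for d
  proof -
    have "?w (TC d) = frechet_derivative (cmap (TC d) \<circ> cinv (TC c)) (at (cmap c p, v c)) (f c)"
      using d v by (simp add: coord_field_def)
    then show ?thesis
      using dchg_TC[OF c(1) d(1) c(2) d(2), of "v c" "fst (f c)" "snd (f c)"] f[OF c(1) d(1) c(2) d(2)] by simp
  qed
  ultimately show ?thesis using TB_eqI[OF q] by (intro ex1I[of _ ?w]) auto
qed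

context
  fixes p v assumes q: "(p, v) \<in> carrier (tangent_bundle A)"
begin

lemma fibre: "p \<in> carrier A" "v \<in> tangent_space A p"
  using q by (auto simp: mem_carrier_TB)

lemma hlift:
  assumes u: "u \<in> tangent_space A p"
  shows "hlift A nabla (p, v) u \<in> tangent_space (tangent_bundle A) (p, v)"
    and "c \<in> A \<Longrightarrow> p \<in> cdom c \<Longrightarrow> hlift A nabla (p, v) u (TC c) = (u c, - Gamma c p (u c) (v c))"
proof -
  have "\<exists>!w. w \<in> tangent_space (tangent_bundle A) (p, v) \<and>
      (\<forall>c\<in>A. p \<in> cdom c \<longrightarrow> w (TC c) = (u c, - Gamma c p (u c) (v c)))"
  proof (rule TB_ex1[OF q], unfold fst_conv snd_conv)
    fix c d assume cd: "c \<in> A" "d \<in> A" "p \<in> cdom c" "p \<in> cdom d"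
    have ud: "u d = dchg c d (cmap c p) (u c)" and vd: "v d = dchg c d (cmap c p) (v c)"
      using tangent_space_change[OF u cd] tangent_space_change[OF fibre(2) cd] .
    show "(u d, - Gamma d p (u d) (v d)) = (dchg c d (cmap c p) (u c),
        frechet_derivative (\<lambda>x. dchg c d x (v c)) (at (cmap c p)) (u c) +
        dchg c d (cmap c p) (- Gamma c p (u c) (v c)))"
      unfolding ud vd christoffel_change[OF cd(1,3,2,4)]
      by (simp add: linear_neg[OF linear_dchg[OF cd]])
  qed
  from theI'[OF this]
  show "hlift A nabla (p, v) u \<in> tangent_space (tangent_bundle A) (p, v)"
    "c \<in> A \<Longrightarrow> p \<in> cdom c \<Longrightarrow> hlift A nabla (p, v) u (TC c) = (u c, - Gamma c p (u c) (v c))"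
    unfolding hlift_def by auto
qed

lemma vlift:
  assumes u: "u \<in> tangent_space A p"
  shows "vlift A (p, v) u \<in> tangent_space (tangent_bundle A) (p, v)"
    and "c \<in> A \<Longrightarrow> p \<in> cdom c \<Longrightarrow> vlift A (p, v) u (TC c) = (0, u c)"
proof -
  have "\<exists>!w. w \<in> tangent_space (tangent_bundle A) (p, v) \<and>
      (\<forall>c\<in>A. p \<in> cdom c \<longrightarrow> w (TC c) = (0, u c))"
  proof (rule TB_ex1[OF q], unfold fst_conv snd_conv)
    fix c d assume cd: "c \<in> A" "d \<in> A" "p \<in> cdom c" "p \<in> cdom d"
    have "((\<lambda>x. dchg c d x (v c)) has_derivative
        frechet_derivative (\<lambda>x. dchg c d x (v c)) (at (cmap c p))) (at (cmap c p))"
      by (rule smooth_on_has_derivative[OF smooth_on_frechet_derivative[OF smooth_chg[OF cd(1,2)]]])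
        (use cd in auto)
    then show "(0, u d) = (dchg c d (cmap c p) 0,
        frechet_derivative (\<lambda>x. dchg c d x (v c)) (at (cmap c p)) 0 + dchg c d (cmap c p) (u c))"
      using tangent_space_change[OF u cd] linear_0[OF linear_dchg[OF cd]] linear_0[OF has_derivative_linear]
      by simp
  qed
  from theI'[OF this]
  show "vlift A (p, v) u \<in> tangent_space (tangent_bundle A) (p, v)"
    "c \<in> A \<Longrightarrow> p \<in> cdom c \<Longrightarrow> vlift A (p, v) u (TC c) = (0, u c)"
    unfolding vlift_def by auto
qed

end

text \<open>The inverse of the splitting of a tangent vector of the bundle into \<open>hpart\<close> and \<open>vpart\<close>.\<close>
definition lift :: "('a, 'e) tpoint \<Rightarrow> ('a, 'e) tvec \<Rightarrow> ('a, 'e) tvec \<Rightarrow> (('a, 'e) tpoint, 'e \<times> 'e) tvec"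
  where "lift q x y = hlift A nabla q x + vlift A q y"

context
  fixes p v assumes q: "(p, v) \<in> carrier (tangent_bundle A)"
begin

lemma lift_in [simp, intro]:
  "x \<in> tangent_space A p \<Longrightarrow> y \<in> tangent_space A p \<Longrightarrow>
    lift (p, v) x y \<in> tangent_space (tangent_bundle A) (p, v)"
  unfolding lift_def by (intro TB.tangent_space_closed hlift(1) vlift(1) q)

lemma lift_comp:
  "x \<in> tangent_space A p \<Longrightarrow> y \<in> tangent_space A p \<Longrightarrow> c \<in> A \<Longrightarrow> p \<in> cdom c \<Longrightarrow>
    lift (p, v) x y (TC c) = (x c, y c - Gamma c p (x c) (v c))"
  by (simp add: lift_def hlift(2)[OF q] vlift(2)[OF q])

lemma lift_add:
  assumes "x \<in> tangent_space A p" "y \<in> tangent_space A p" "x' \<in> tangent_space A p" "y' \<in> tangent_space A p"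
  shows "lift (p, v) x y + lift (p, v) x' y' = lift (p, v) (x + x') (y + y')"
  by (rule TB_eqI[OF q])
    (use assms in \<open>auto simp: lift_comp linear_add[OF linear_christoffel_left]\<close>)

lemma lift_scaleR:
  assumes "x \<in> tangent_space A p" "y \<in> tangent_space A p"
  shows "r *\<^sub>R lift (p, v) x y = lift (p, v) (r *\<^sub>R x) (r *\<^sub>R y)"
  by (rule TB_eqI[OF q])
    (use assms in \<open>auto simp: lift_comp linear_cmul[OF linear_christoffel_left] scaleR_diff_right\<close>)

lemma lift_uminus:
  assumes "x \<in> tangent_space A p" "y \<in> tangent_space A p"
  shows "- lift (p, v) x y = lift (p, v) (- x) (- y)"
  using lift_scaleR[OF assms, of "- 1"] by simp

lemma lift_eq_iff:
  assumes "x \<in> tangent_space A p" "y \<in> tangent_space A p" "x' \<in> tangent_space A p" "y' \<in> tangent_space A p"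
  shows "lift (p, v) x y = lift (p, v) x' y' \<longleftrightarrow> x = x' \<and> y = y'"
proof
  assume eq: "lift (p, v) x y = lift (p, v) x' y'"
  obtain c where c: "c \<in> A" "p \<in> cdom c" using fibre(1)[OF q] carrier_chart by blast
  have "lift (p, v) x y (TC c) = lift (p, v) x' y' (TC c)" using eq by simp
  then have "x c = x' c" "y c = y' c" using assms c by (auto simp: lift_comp)
  then show "x = x' \<and> y = y'" using tangent_eqI assms c by blast
qed simp

text \<open>Solving \<open>lift_comp\<close> for the two parts; the Christoffel term changes sign.\<close>
lemma lift_coord_field:
  assumes c: "c \<in> A" "p \<in> cdom c"
  shows "coord_field (tangent_bundle A) (TC c) (a, b) (p, v) =
    lift (p, v) (coord_field A c a p) (coord_field A c (b + Gamma c p a (v c)) p)"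
  by (rule TB.tangent_eqI[of _ "(p, v)" _ "TC c"])
    (use c fibre[OF q] in \<open>auto simp: lift_comp\<close>)

lemma lift_cases:
  assumes "w \<in> tangent_space (tangent_bundle A) (p, v)"
  obtains x y where "x \<in> tangent_space A p" "y \<in> tangent_space A p" "w = lift (p, v) x y"
proof -
  obtain c where c: "c \<in> A" "p \<in> cdom c" using fibre(1)[OF q] carrier_chart by blast
  have "w = coord_field (tangent_bundle A) (TC c) (fst (w (TC c)), snd (w (TC c))) (p, v)"
    using TB.coord_field_self[OF assms, of "TC c"] c fibre[OF q] by simp
  then show thesis using that lift_coord_field[OF c] c by (metis coord_field_in)
qed

lemma hlift_zero [simp]: "hlift A nabla (p, v) 0 = 0"
  by (rule TB_eqI[OF q])
    (auto simp: hlift[OF q] linear_0[OF linear_christoffel_left] zero_prod_def)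

lemma vlift_zero [simp]: "vlift A (p, v) 0 = 0"
  by (rule TB_eqI[OF q]) (auto simp: vlift[OF q] zero_prod_def)

lemma hlift_eq_lift: "hlift A nabla (p, v) x = lift (p, v) x 0"
  by (simp add: lift_def)

lemma vlift_eq_lift: "vlift A (p, v) y = lift (p, v) 0 y"
  by (simp add: lift_def)

lemma hpart_lift [simp]:
  assumes "x \<in> tangent_space A p" "y \<in> tangent_space A p"
  shows "hpart A nabla (p, v) (lift (p, v) x y) = x"
  unfolding hpart_def fst_conv lift_def[symmetric]
  by (rule the_equality) (use assms lift_eq_iff in auto)

lemma vpart_lift [simp]:
  assumes "x \<in> tangent_space A p" "y \<in> tangent_space A p"
  shows "vpart A nabla (p, v) (lift (p, v) x y) = y"
  unfolding vpart_def fst_conv lift_def[symmetric]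
  by (rule the_equality) (use assms lift_eq_iff in auto)

end

end


section \<open>Hyperbolic pairs and neutral signature\<close>

lemma independent_orthogonal:
  fixes G :: "'v::real_vector \<Rightarrow> 'v \<Rightarrow> real"
  assumes V: "subspace V" and S: "finite S" "S \<subseteq> V"
    and add: "\<And>x y z. x \<in> V \<Longrightarrow> y \<in> V \<Longrightarrow> z \<in> V \<Longrightarrow> G (x + y) z = G x z + G y z"
    and scale: "\<And>r x z. x \<in> V \<Longrightarrow> z \<in> V \<Longrightarrow> G (r *\<^sub>R x) z = r * G x z"
    and orth: "\<And>x y. x \<in> S \<Longrightarrow> y \<in> S \<Longrightarrow> x \<noteq> y \<Longrightarrow> G x y = 0" and nz: "\<And>x. x \<in> S \<Longrightarrow> G x x \<noteq> 0"
  shows "independent S"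
proof (rule independent_if_scalars_zero[OF S(1)])
  fix f y assume 0: "(\<Sum>x\<in>S. f x *\<^sub>R x) = 0" and y: "y \<in> S"
  have yV: "y \<in> V" using y S by auto
  have zero: "G 0 y = 0" using scale[of 0 y 0] yV subspace_0[OF V] by simp
  have "G (\<Sum>x\<in>T. f x *\<^sub>R x) y = (\<Sum>x\<in>T. f x * G x y)" if "T \<subseteq> S" for T
    using finite_subset[OF that S(1)] that
  proof (induction T)
    case (insert x T)
    have "(\<Sum>x\<in>T. f x *\<^sub>R x) \<in> V" "f x *\<^sub>R x \<in> V"
      using insert.prems S by (auto intro!: subspace_sum[OF V] subspace_mul[OF V])
    then show ?case using insert S yV by (simp add: add scale subset_iff)
  qed (simp add: zero)
  from this[of S] have "(\<Sum>x\<in>S. f x * G x y) = 0" using 0 zero by simp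
  moreover have "(\<Sum>x\<in>S. f x * G x y) = (\<Sum>x\<in>S. if x = y then f y * G y y else 0)"
    by (rule sum.cong) (use orth y in auto)
  ultimately show "f y = 0" using nz[OF y] S(1) y by simp
qed

text \<open>With the value \<open>1 / 2\<close> for the product of the two members of a hyperbolic pair, their sum and
  their difference are orthogonal and have squares \<open>1\<close> and \<open>-1\<close>. So an orthonormal basis is at hand
  without diagonalising the form.\<close>
lemma has_signature_hyperbolic:
  fixes G :: "'v::real_vector \<Rightarrow> 'v \<Rightarrow> real" and h k :: "'i \<Rightarrow> 'v"
  assumes I: "finite I" and V: "subspace V"
    and add: "\<And>x y z. x \<in> V \<Longrightarrow> y \<in> V \<Longrightarrow> z \<in> V \<Longrightarrow> G (x + y) z = G x z + G y z"
    and scale: "\<And>r x z. x \<in> V \<Longrightarrow> z \<in> V \<Longrightarrow> G (r *\<^sub>R x) z = r * G x z"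
    and sym: "\<And>x y. x \<in> V \<Longrightarrow> y \<in> V \<Longrightarrow> G x y = G y x"
    and hk: "\<And>i. i \<in> I \<Longrightarrow> h i \<in> V" "\<And>i. i \<in> I \<Longrightarrow> k i \<in> V"
    and hh: "\<And>i j. i \<in> I \<Longrightarrow> j \<in> I \<Longrightarrow> G (h i) (h j) = 0"
    and kk: "\<And>i j. i \<in> I \<Longrightarrow> j \<in> I \<Longrightarrow> G (k i) (k j) = 0"
    and kh: "\<And>i j. i \<in> I \<Longrightarrow> j \<in> I \<Longrightarrow> G (k i) (h j) = (if i = j then 1 / 2 else 0)"
    and span: "V \<subseteq> span (h ` I \<union> k ` I)"
  shows "has_signature V G (card I) (card I)"
proof -
  \<comment> \<open>\<open>s = 1\<close> gives the positive vectors, \<open>s = -1\<close> the negative ones\<close>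
  define e where "e s i = h i + s *\<^sub>R k i" for s :: real and i
  have eV: "e s i \<in> V" if "i \<in> I" for s i
    using that hk by (auto simp: e_def intro!: subspace_add[OF V] subspace_mul[OF V])
  have add': "G z (x + y) = G z x + G z y" if "x \<in> V" "y \<in> V" "z \<in> V" for x y z
    using add[OF that] sym that subspace_add[OF V that(1,2)] by simp
  have scale': "G z (r *\<^sub>R x) = r * G z x" if "x \<in> V" "z \<in> V" for r x z
    using scale[OF that] sym that subspace_mul[OF V that(1)] by simp
  have hk': "G (h i) (k j) = (if i = j then 1 / 2 else 0)" if "i \<in> I" "j \<in> I" for i j
    using kh[OF that(2,1)] sym hk that by auto
  have Ge: "G (e s i) (e t j) = (if i = j then (s + t) / 2 else 0)" if "i \<in> I" "j \<in> I" for s t i j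
    using that hk by (simp add: e_def add add' scale scale' hh kk kh hk' subspace_add[OF V]
        subspace_mul[OF V] add_divide_distrib)
  let ?P = "e 1 ` I" and ?N = "e (- 1) ` I"
  have inj: "inj_on (e s) I" if "s = 1 \<or> s = - 1" for s
  proof (rule inj_onI)
    fix i j assume ij: "i \<in> I" "j \<in> I" "e s i = e s j"
    then have "G (e s i) (e s j) = s" using Ge[of j j s s] by simp
    then show "i = j" using Ge[OF ij(1,2), of s s] that by (auto split: if_splits)
  qed
  have P: "G x x = 1" if "x \<in> ?P" for x using that Ge by auto
  have N: "G x x = - 1" if "x \<in> ?N" for x using that Ge by auto
  have orth: "G x y = 0" if "x \<in> ?P \<union> ?N" "y \<in> ?P \<union> ?N" "x \<noteq> y" for x y
    using that Ge by auto
  have sub: "?P \<union> ?N \<subseteq> V" using eV by auto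
  have "h ` I \<union> k ` I \<subseteq> span (?P \<union> ?N)"
  proof -
    have "h i \<in> span (?P \<union> ?N) \<and> k i \<in> span (?P \<union> ?N)" if i: "i \<in> I" for i
    proof -
      have "e 1 i \<in> span (?P \<union> ?N)" "e (- 1) i \<in> span (?P \<union> ?N)"
        using i by (auto intro!: span_base)
      note span_scale[OF span_add[OF this], of "1 / 2"] span_scale[OF span_diff[OF this], of "1 / 2"]
      moreover have "(1 / 2) *\<^sub>R (e 1 i + e (- 1) i) = h i" "(1 / 2) *\<^sub>R (e 1 i - e (- 1) i) = k i"
        by (simp_all add: e_def scaleR_add_right[symmetric] scaleR_2[symmetric] del: scaleR_add_right)
      ultimately show ?thesis by simp
    qed
    then show ?thesis by auto
  qed
  then have "V \<subseteq> span (?P \<union> ?N)"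
    using span span_minimal[OF _ subspace_span] by (meson subset_trans)
  moreover have "span (?P \<union> ?N) \<subseteq> V" by (rule span_minimal[OF sub V])
  moreover have "independent (?P \<union> ?N)"
    by (rule independent_orthogonal[OF V _ sub add scale orth]) (use I P N in force)+
  moreover have "?P \<inter> ?N = {}" using P N by force
  moreover have "card ?P = card I" "card ?N = card I" using inj card_image by blast+
  ultimately show ?thesis
    unfolding has_signature_def using I P N orth
    by (intro exI[of _ ?P] exI[of _ ?N]) (simp add: subset_antisym)
qed


section \<open>Tensor fields on the tangent bundle\<close>

lemma tensor11D:
  assumes "tensor11 A P" "p \<in> carrier A" "x \<in> tangent_space A p"
  shows "P p x \<in> tangent_space A p"
    and "y \<in> tangent_space A p \<Longrightarrow> P p (x + y) = P p x + P p y"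
    and "P p (r *\<^sub>R x) = r *\<^sub>R P p x"
  using assms unfolding tensor11_def by blast+

lemma tensor02D:
  assumes "tensor02 A g" "p \<in> carrier A" "x \<in> tangent_space A p" "z \<in> tangent_space A p"
  shows "y \<in> tangent_space A p \<Longrightarrow> g p (x + y) z = g p x z + g p y z"
    and "y \<in> tangent_space A p \<Longrightarrow> g p z (x + y) = g p z x + g p z y"
    and "g p (r *\<^sub>R x) z = r * g p x z"
    and "g p z (r *\<^sub>R x) = r * g p z x"
  using assms unfolding tensor02_def by blast+

context atlas
begin

lemma cdom_carrier: "c \<in> A \<Longrightarrow> p \<in> cdom c \<Longrightarrow> p \<in> carrier A"
  by (auto simp: carrier_def)

lemma tensor11_zero: "tensor11 A (\<lambda>p x. 0)"
  by (auto simp: tensor11_def smooth_on_const)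

lemma tensor11_ident: "tensor11 A (\<lambda>p x. x)"
  unfolding tensor11_def
proof (intro conjI ballI allI)
  fix c \<xi> assume c: "c \<in> A"
  show "smooth_on (cmap c ` cdom c) (\<lambda>x. coord_field A c \<xi> (cinv c x) c)"
    by (subst smooth_on_cong[OF open_cmap[OF c], where g="\<lambda>x. \<xi>"]) (use c in \<open>auto intro: smooth_on_const\<close>)
qed auto

lemma tensor11_uminus:
  assumes J: "tensor11 A J"
  shows "tensor11 A (\<lambda>p x. - J p x)"
  unfolding tensor11_def
proof (intro conjI ballI allI)
  fix p x y r assume *: "p \<in> carrier A" "x \<in> tangent_space A p" "y \<in> tangent_space A p"
  show "- J p x \<in> tangent_space A p" using tensor11D(1)[OF J *(1,2)] by blast
  show "- J p (x + y) = - J p x + - J p y" using tensor11D(2)[OF J *] by simp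
  show "- J p (r *\<^sub>R x) = r *\<^sub>R - J p x" using tensor11D(3)[OF J *(1,2)] by simp
next
  fix c \<xi> assume c: "c \<in> A"
  then have "smooth_on (cmap c ` cdom c) (\<lambda>x. J (cinv c x) (coord_field A c \<xi> (cinv c x)) c)"
    using J unfolding tensor11_def by blast
  then show "smooth_on (cmap c ` cdom c) (\<lambda>x. (- J (cinv c x) (coord_field A c \<xi> (cinv c x))) c)"
    using smooth_on_uminus[OF open_cmap[OF c]] by simp
qed

lemma open_cmap_Times: "c \<in> A \<Longrightarrow> open (cmap c ` cdom c \<times> (UNIV :: 'e set))"
  by (simp add: open_Times open_cmap)

lemma cmap_TC_cdom: "c \<in> A \<Longrightarrow> cmap (TC c) ` cdom (TC c) = cmap c ` cdom c \<times> UNIV"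
  unfolding cdom_TC by (rule cmap_TC_image) auto

lemma smooth_tensor11:
  assumes J: "tensor11 A J" and c: "c \<in> A" and f: "smooth_on (cmap c ` cdom c \<times> (UNIV :: 'e set)) f"
  shows "smooth_on (cmap c ` cdom c \<times> (UNIV :: 'e set))
    (\<lambda>z. J (cinv c (fst z)) (coord_field A c (f z) (cinv c (fst z))) c)"
proof (rule smooth_on_linear_family[OF open_cmap_Times[OF c] _ _ f])
  show "smooth_on (cmap c ` cdom c \<times> (UNIV :: 'e set))
      (\<lambda>z. J (cinv c (fst z)) (coord_field A c b (cinv c (fst z))) c)" for b
    by (rule smooth_on_compose_fst[OF open_cmap[OF c]]) (use J c in \<open>unfold tensor11_def, blast\<close>)
  fix z :: "'e \<times> 'e" assume "z \<in> cmap c ` cdom c \<times> UNIV"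
  then obtain p where p: "p \<in> cdom c" "fst z = cmap c p" by auto
  have "linear (\<lambda>\<xi>. J p (coord_field A c \<xi> p) c)"
    using tensor11D[OF J cdom_carrier[OF c p(1)] coord_field_in[OF c p(1)]]
    by (intro linearI)
      (simp_all add: linear_add[OF linear_coord_field[OF c p(1)]] linear_cmul[OF linear_coord_field[OF c p(1)]] c p(1))
  then show "linear (\<lambda>\<xi>. J (cinv c (fst z)) (coord_field A c \<xi> (cinv c (fst z))) c)"
    using c p by simp
qed

lemma smooth_tensor02:
  assumes g: "tensor02 A g" and c: "c \<in> A"
    and f: "smooth_on (cmap c ` cdom c \<times> (UNIV :: 'e set)) f"
    and h: "smooth_on (cmap c ` cdom c \<times> (UNIV :: 'e set)) h"
  shows "smooth_on (cmap c ` cdom c \<times> (UNIV :: 'e set))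
    (\<lambda>z. g (cinv c (fst z)) (coord_field A c (f z) (cinv c (fst z))) (coord_field A c (h z) (cinv c (fst z))))"
proof (rule smooth_on_bilinear_family[OF open_cmap_Times[OF c] _ _ _ f h])
  show "smooth_on (cmap c ` cdom c \<times> (UNIV :: 'e set))
      (\<lambda>z. g (cinv c (fst z)) (coord_field A c a (cinv c (fst z))) (coord_field A c b (cinv c (fst z))))" for a b
    by (rule smooth_on_compose_fst[OF open_cmap[OF c]]) (use g c in \<open>unfold tensor02_def, blast\<close>)
  fix z :: "'e \<times> 'e" and b assume "z \<in> cmap c ` cdom c \<times> UNIV"
  then obtain p where p: "p \<in> cdom c" "fst z = cmap c p" by auto
  note g' = tensor02D[OF g cdom_carrier[OF c p(1)] coord_field_in[OF c p(1)] coord_field_in[OF c p(1)]]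
  note [simp] = linear_add[OF linear_coord_field[OF c p(1)]] linear_cmul[OF linear_coord_field[OF c p(1)]]
  have "linear (\<lambda>\<xi>. g p (coord_field A c b p) (coord_field A c \<xi> p))"
    "linear (\<lambda>\<xi>. g p (coord_field A c \<xi> p) (coord_field A c b p))"
    using g' by (auto intro!: linearI simp: c p(1))
  then show "linear (\<lambda>\<xi>. g (cinv c (fst z)) (coord_field A c b (cinv c (fst z))) (coord_field A c \<xi> (cinv c (fst z))))"
    "linear (\<lambda>\<xi>. g (cinv c (fst z)) (coord_field A c \<xi> (cinv c (fst z))) (coord_field A c b (cinv c (fst z))))"
    using c p by simp_all
qed

end

context connection
begin

interpretation TB: atlas "tangent_bundle A"
  by unfold_locales (rule smooth_atlas_tangent_bundle)

lemma smooth_christoffel: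
  assumes c: "c \<in> A"
    and f: "smooth_on (cmap c ` cdom c \<times> (UNIV :: 'e set)) f"
    and h: "smooth_on (cmap c ` cdom c \<times> (UNIV :: 'e set)) h"
  shows "smooth_on (cmap c ` cdom c \<times> (UNIV :: 'e set)) (\<lambda>z. Gamma c (cinv c (fst z)) (f z) (h z))"
proof (rule smooth_on_bilinear_family[OF open_cmap_Times[OF c] _ _ _ f h])
  show "smooth_on (cmap c ` cdom c \<times> (UNIV :: 'e set)) (\<lambda>z. Gamma c (cinv c (fst z)) a b)" for a b
    by (rule smooth_on_compose_fst[OF open_cmap[OF c] smooth_on_christoffel[OF c]])
  fix z :: "'e \<times> 'e" and b assume "z \<in> cmap c ` cdom c \<times> UNIV"
  then have p: "cinv c (fst z) \<in> cdom c" using c by auto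
  show "linear (Gamma c (cinv c (fst z)) b)"
    "linear (\<lambda>a. Gamma c (cinv c (fst z)) a b)"
    using linear_christoffel_right[OF c p] linear_christoffel_left[OF c p] .
qed

text \<open>At the point with induced coordinates \<open>z\<close>, the vector with components \<open>\<zeta> = (a, b)\<close> has a
  horizontal part with components \<open>a\<close>, which already contributes \<open>- \<Gamma>(a, y)\<close> to \<open>b\<close>; what remains of
  \<open>b\<close> are the components of the vertical part.\<close>
definition vcoord :: "('a, 'e) chart \<Rightarrow> 'e \<times> 'e \<Rightarrow> 'e \<times> 'e \<Rightarrow> 'e"
  where "vcoord c \<zeta> z = snd \<zeta> + Gamma c (cinv c (fst z)) (fst \<zeta>) (snd z)"

lemma smooth_vcoord: "c \<in> A \<Longrightarrow> smooth_on (cmap c ` cdom c \<times> (UNIV :: 'e set)) (vcoord c \<zeta>)"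
  unfolding vcoord_def
  by (intro smooth_on_add smooth_christoffel smooth_on_const smooth_on_snd open_cmap_Times)

lemma coord_field_TB:
  assumes c: "c \<in> A" and z: "z \<in> cmap c ` cdom c \<times> UNIV"
  defines "p \<equiv> cinv c (fst z)"
  shows "cinv (TC c) z = (p, coord_field A c (snd z) p)"
    and "coord_field (tangent_bundle A) (TC c) \<zeta> (cinv (TC c) z) =
      lift (p, coord_field A c (snd z) p) (coord_field A c (fst \<zeta>) p) (coord_field A c (vcoord c \<zeta> z) p)"
    and "p \<in> cdom c" and "(p, coord_field A c (snd z) p) \<in> carrier (tangent_bundle A)"
proof -
  show p: "p \<in> cdom c" using c z by (auto simp: p_def)
  then show q: "(p, coord_field A c (snd z) p) \<in> carrier (tangent_bundle A)"
    using c cdom_carrier by (simp add: mem_carrier_TB)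
  show eq: "cinv (TC c) z = (p, coord_field A c (snd z) p)"
    using cinv_TC[OF c, of "fst z" "snd z"] z by (auto simp: p_def)
  show "coord_field (tangent_bundle A) (TC c) \<zeta> (cinv (TC c) z) =
      lift (p, coord_field A c (snd z) p) (coord_field A c (fst \<zeta>) p) (coord_field A c (vcoord c \<zeta> z) p)"
    unfolding eq using lift_coord_field[OF q c p, of "fst \<zeta>" "snd \<zeta>"] c p
    by (simp add: vcoord_def p_def[symmetric])
qed

text \<open>All three structures are block matrices of tensor fields of the base with respect to the splitting
  into horizontal and vertical vectors. Smoothness of such a block matrix in induced coordinates
  reduces to that of the blocks and of the Christoffel symbols, which enter through \<open>vcoord\<close> and
  through the components of horizontal lifts.\<close>
lemma tensor11_block:
  assumes P: "tensor11 A P" and Q: "tensor11 A Q" and R: "tensor11 A R" and S: "tensor11 A S"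
    and K: "\<And>p v x y. (p, v) \<in> carrier (tangent_bundle A) \<Longrightarrow> x \<in> tangent_space A p \<Longrightarrow>
      y \<in> tangent_space A p \<Longrightarrow> K (p, v) (lift (p, v) x y) = lift (p, v) (P p x + Q p y) (R p x + S p y)"
  shows "tensor11 (tangent_bundle A) K"
  unfolding tensor11_def
proof (intro conjI ballI allI)
  fix q w z r
  assume q': "q \<in> carrier (tangent_bundle A)"
    and w: "w \<in> tangent_space (tangent_bundle A) q" and z: "z \<in> tangent_space (tangent_bundle A) q"
  obtain p v where pv: "q = (p, v)" by fastforce
  note q = q'[unfolded pv]
  obtain x y where x: "x \<in> tangent_space A p" and y: "y \<in> tangent_space A p" and w_eq: "w = lift (p, v) x y"
    using lift_cases[OF q w[unfolded pv]] .
  obtain x' y' where x': "x' \<in> tangent_space A p" and y': "y' \<in> tangent_space A p" and z_eq: "z = lift (p, v) x' y'"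
    using lift_cases[OF q z[unfolded pv]] .
  note p = fibre(1)[OF q]
  note in1 = tensor11D(1)[OF P p] tensor11D(1)[OF Q p] tensor11D(1)[OF R p] tensor11D(1)[OF S p]
  show "K q w \<in> tangent_space (tangent_bundle A) q"
    unfolding pv w_eq K[OF q x y] by (intro lift_in q tangent_space_closed in1 x y)
  have "K q (w + z) = lift (p, v) (P p (x + x') + Q p (y + y')) (R p (x + x') + S p (y + y'))"
    unfolding pv w_eq z_eq lift_add[OF q x y x' y'] by (intro K q tangent_space_closed x y x' y')
  also have "\<dots> = lift (p, v) ((P p x + Q p y) + (P p x' + Q p y')) ((R p x + S p y) + (R p x' + S p y'))"
    unfolding tensor11D(2)[OF P p x x'] tensor11D(2)[OF Q p y y'] tensor11D(2)[OF R p x x']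
      tensor11D(2)[OF S p y y'] by (simp only: ac_simps)
  also have "\<dots> = K q w + K q z"
    unfolding pv w_eq z_eq K[OF q x y] K[OF q x' y']
    by (intro lift_add[symmetric] q tangent_space_closed in1 x y x' y')
  finally show "K q (w + z) = K q w + K q z" .
  have "K q (r *\<^sub>R w) = lift (p, v) (P p (r *\<^sub>R x) + Q p (r *\<^sub>R y)) (R p (r *\<^sub>R x) + S p (r *\<^sub>R y))"
    unfolding pv w_eq lift_scaleR[OF q x y] by (intro K q tangent_space_closed x y)
  also have "\<dots> = lift (p, v) (r *\<^sub>R (P p x + Q p y)) (r *\<^sub>R (R p x + S p y))"
    by (simp only: tensor11D(3)[OF P p x] tensor11D(3)[OF Q p y] tensor11D(3)[OF R p x]
        tensor11D(3)[OF S p y] scaleR_add_right)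
  also have "\<dots> = r *\<^sub>R K q w"
    unfolding pv w_eq K[OF q x y]
    by (intro lift_scaleR[symmetric] q tangent_space_closed in1 x y)
  finally show "K q (r *\<^sub>R w) = r *\<^sub>R K q w" .
next
  fix C \<zeta> assume "C \<in> tangent_bundle A"
  then obtain c where c: "c \<in> A" and C: "C = TC c" by (auto simp: tangent_bundle_def)
  let ?S = "cmap c ` cdom c \<times> (UNIV :: 'e set)"
  define app where "app T f z = T (cinv c (fst z)) (coord_field A c (f z) (cinv c (fst z))) c"
    for T :: "'a \<Rightarrow> ('a, 'e) tvec \<Rightarrow> ('a, 'e) tvec" and f and z :: "'e \<times> 'e"
  have app: "smooth_on ?S (app T f)" if "tensor11 A T" "smooth_on ?S f" for T f
    unfolding app_def by (rule smooth_tensor11[OF that(1) c that(2)])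
  let ?X = "\<lambda>z. app P (\<lambda>z. fst \<zeta>) z + app Q (vcoord c \<zeta>) z"
  let ?Y = "\<lambda>z. app R (\<lambda>z. fst \<zeta>) z + app S (vcoord c \<zeta>) z"
  have X: "smooth_on ?S ?X" and Y: "smooth_on ?S ?Y"
    by (intro smooth_on_add open_cmap_Times c app P Q R S smooth_on_const smooth_vcoord)+
  have "smooth_on ?S (\<lambda>z. (?X z, ?Y z - Gamma c (cinv c (fst z)) (?X z) (snd z)))"
    by (intro smooth_on_Pair smooth_on_diff smooth_christoffel open_cmap_Times c X Y smooth_on_snd)
  moreover have "K (cinv C z) (coord_field (tangent_bundle A) C \<zeta> (cinv C z)) C =
      (?X z, ?Y z - Gamma c (cinv c (fst z)) (?X z) (snd z))" if z: "z \<in> ?S" for z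
  proof -
    let ?p = "cinv c (fst z)"
    let ?v = "coord_field A c (snd z) ?p" and ?x = "coord_field A c (fst \<zeta>) ?p"
      and ?y = "coord_field A c (vcoord c \<zeta> z) ?p"
    note tb = coord_field_TB[OF c z]
    have x: "?x \<in> tangent_space A ?p" and y: "?y \<in> tangent_space A ?p" using c tb(3) by auto
    note p = fibre(1)[OF tb(4)]
    note in1 = tensor11D(1)[OF P p x] tensor11D(1)[OF Q p y] tensor11D(1)[OF R p x] tensor11D(1)[OF S p y]
    have "K (cinv C z) (coord_field (tangent_bundle A) C \<zeta> (cinv C z)) C =
        lift (?p, ?v) (P ?p ?x + Q ?p ?y) (R ?p ?x + S ?p ?y) (TC c)"
      unfolding C tb(2) unfolding tb(1) K[OF tb(4) x y] ..
    also have "\<dots> = ((P ?p ?x + Q ?p ?y) c, (R ?p ?x + S ?p ?y) c - Gamma c ?p ((P ?p ?x + Q ?p ?y) c) (?v c))"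
      by (intro lift_comp tb(4) tangent_space_closed in1 c tb(3))
    also have "?v c = snd z" using c tb(3) by simp
    finally show ?thesis by (simp add: app_def)
  qed
  ultimately show "smooth_on (cmap C ` cdom C) (\<lambda>z. K (cinv C z) (coord_field (tangent_bundle A) C \<zeta> (cinv C z)) C)"
    unfolding C cmap_TC_cdom[OF c] by (subst smooth_on_cong[OF open_cmap_Times[OF c]]) auto
qed

end


section \<open>The structure on the tangent bundle\<close>

context connection
begin

interpretation TB: atlas "tangent_bundle A"
  by unfold_locales (rule smooth_atlas_tangent_bundle)

context
  fixes p v x y
  assumes q: "(p, v) \<in> carrier (tangent_bundle A)"
    and x: "x \<in> tangent_space A p" and y: "y \<in> tangent_space A p"
begin

lemma hlift_minus_vlift: "vlift A (p, v) x - hlift A nabla (p, v) y = lift (p, v) (- y) x"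
proof -
  have "- lift (p, v) y 0 = lift (p, v) (- y) 0"
    using lift_uminus[OF q y zero_tangent] by simp
  then have "lift (p, v) 0 x - lift (p, v) y 0 = lift (p, v) 0 x + lift (p, v) (- y) 0" by simp
  also have "\<dots> = lift (p, v) (- y) x"
    using lift_add[OF q zero_tangent x tangent_space_closed(3)[OF y] zero_tangent] by simp
  finally show ?thesis by (simp only: hlift_eq_lift[OF q] vlift_eq_lift[OF q])
qed

lemma TM_J2_lift: "TM_J2 A nabla (p, v) (lift (p, v) x y) = lift (p, v) (- y) x"
  by (simp only: TM_J2_def hpart_lift[OF q x y] vpart_lift[OF q x y] hlift_minus_vlift)

lemma TM_metric_lift:
  assumes "x' \<in> tangent_space A p" "y' \<in> tangent_space A p"
  shows "TM_metric A nabla g (p, v) (lift (p, v) x y) (lift (p, v) x' y') = g p x y' + g p y x'"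
  by (simp only: TM_metric_def hpart_lift[OF q x y] vpart_lift[OF q x y] hpart_lift[OF q assms]
      vpart_lift[OF q assms] fst_conv)

end

context
  fixes p v x y J
  assumes q: "(p, v) \<in> carrier (tangent_bundle A)" and J: "tensor11 A J"
    and x: "x \<in> tangent_space A p" and y: "y \<in> tangent_space A p"
begin

lemma TM_J1_lift: "TM_J1 A nabla J (p, v) (lift (p, v) x y) = lift (p, v) (- J p x) (J p y)"
  using hlift_minus_vlift[OF q tensor11D(1)[OF J fibre(1)[OF q] y] tensor11D(1)[OF J fibre(1)[OF q] x]]
  by (simp only: TM_J1_def hpart_lift[OF q x y] vpart_lift[OF q x y] fst_conv uminus_add_conv_diff)

lemma TM_J3_lift: "TM_J3 A nabla J (p, v) (lift (p, v) x y) = lift (p, v) (J p y) (J p x)"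
  unfolding TM_J3_def hpart_lift[OF q x y] vpart_lift[OF q x y] fst_conv by (simp only: lift_def add.commute)

end

lemma tensor11_TM_J:
  assumes J: "tensor11 A J"
  shows "tensor11 (tangent_bundle A) (TM_J1 A nabla J)" "tensor11 (tangent_bundle A) (TM_J2 A nabla)"
    "tensor11 (tangent_bundle A) (TM_J3 A nabla J)"
proof -
  note I = tensor11_ident and Z = tensor11_zero and mJ = tensor11_uminus[OF J]
  show "tensor11 (tangent_bundle A) (TM_J1 A nabla J)"
    by (rule tensor11_block[OF mJ Z Z J]) (simp add: TM_J1_lift[OF _ J])
  show "tensor11 (tangent_bundle A) (TM_J2 A nabla)"
    by (rule tensor11_block[OF Z tensor11_uminus[OF I] I Z]) (simp add: TM_J2_lift)
  show "tensor11 (tangent_bundle A) (TM_J3 A nabla J)"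
    by (rule tensor11_block[OF Z J J Z]) (simp add: TM_J3_lift[OF _ J])
qed

text \<open>Nondegeneracy: pairing with vertical vectors tests the horizontal part, and conversely.\<close>
lemma pseudo_riemannian_TM_metric:
  assumes g: "pseudo_riemannian_metric A g"
  shows "pseudo_riemannian_metric (tangent_bundle A) (TM_metric A nabla g)"
proof -
  let ?G = "TM_metric A nabla g"
  have g02: "tensor02 A g"
    and sym: "\<And>p x y. p \<in> carrier A \<Longrightarrow> x \<in> tangent_space A p \<Longrightarrow> y \<in> tangent_space A p \<Longrightarrow> g p x y = g p y x"
    and nondeg: "\<And>p x. p \<in> carrier A \<Longrightarrow> x \<in> tangent_space A p \<Longrightarrow>
      (\<And>y. y \<in> tangent_space A p \<Longrightarrow> g p x y = 0) \<Longrightarrow> x = 0"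
    using g unfolding pseudo_riemannian_metric_def by blast+
  have symG: "?G q w z = ?G q z w" if "q \<in> carrier (tangent_bundle A)"
    "w \<in> tangent_space (tangent_bundle A) q" "z \<in> tangent_space (tangent_bundle A) q" for q w z
  proof -
    obtain p v where pv: "q = (p, v)" by fastforce
    note that' = that
    note q = that(1)[unfolded pv] and p = fibre(1)[OF that(1)[unfolded pv]]
    obtain x y where w: "x \<in> tangent_space A p" "y \<in> tangent_space A p" "w = lift (p, v) x y"
      using lift_cases[OF q that'(2)[unfolded pv]] .
    obtain x' y' where z: "x' \<in> tangent_space A p" "y' \<in> tangent_space A p" "z = lift (p, v) x' y'"
      using lift_cases[OF q that'(3)[unfolded pv]] .
    show ?thesis
      unfolding pv w(3) z(3) TM_metric_lift[OF q w(1,2) z(1,2)] TM_metric_lift[OF q z(1,2) w(1,2)]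
      using sym[OF p] w z by simp
  qed
  have linG: "?G q (w + w') z = ?G q w z + ?G q w' z \<and> ?G q (r *\<^sub>R w) z = r * ?G q w z"
    if "q \<in> carrier (tangent_bundle A)" "w \<in> tangent_space (tangent_bundle A) q"
      "w' \<in> tangent_space (tangent_bundle A) q" "z \<in> tangent_space (tangent_bundle A) q" for q w w' z r
  proof -
    obtain p v where pv: "q = (p, v)" by fastforce
    note that' = that
    note q = that(1)[unfolded pv] and p = fibre(1)[OF that(1)[unfolded pv]]
    obtain x y where w: "x \<in> tangent_space A p" "y \<in> tangent_space A p" "w = lift (p, v) x y"
      using lift_cases[OF q that'(2)[unfolded pv]] .
    obtain x' y' where w': "x' \<in> tangent_space A p" "y' \<in> tangent_space A p" "w' = lift (p, v) x' y'"
      using lift_cases[OF q that'(3)[unfolded pv]] .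
    obtain x'' y'' where z: "x'' \<in> tangent_space A p" "y'' \<in> tangent_space A p" "z = lift (p, v) x'' y''"
      using lift_cases[OF q that'(4)[unfolded pv]] .
    have "?G q (w + w') z = g p (x + x') y'' + g p (y + y') x''"
      unfolding pv w(3) w'(3) z(3) lift_add[OF q w(1,2) w'(1,2)]
      by (intro TM_metric_lift q tangent_space_closed w w' z)
    also have "\<dots> = ?G q w z + ?G q w' z"
      unfolding pv w(3) w'(3) z(3) TM_metric_lift[OF q w(1,2) z(1,2)] TM_metric_lift[OF q w'(1,2) z(1,2)]
        tensor02D(1)[OF g02 p w(1) z(2) w'(1)] tensor02D(1)[OF g02 p w(2) z(1) w'(2)] by simp
    finally have "?G q (w + w') z = ?G q w z + ?G q w' z" .
    moreover have "?G q (r *\<^sub>R w) z = g p (r *\<^sub>R x) y'' + g p (r *\<^sub>R y) x''"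
      unfolding pv w(3) z(3) lift_scaleR[OF q w(1,2)]
      by (intro TM_metric_lift q tangent_space_closed w z)
    moreover have "\<dots> = r * ?G q w z"
      unfolding pv w(3) z(3) TM_metric_lift[OF q w(1,2) z(1,2)]
        tensor02D(3)[OF g02 p w(1) z(2)] tensor02D(3)[OF g02 p w(2) z(1)] by (simp add: distrib_left)
    ultimately show ?thesis by simp
  qed
  have smoothG: "smooth_on (cmap C ` cdom C) (\<lambda>z. ?G (cinv C z) (coord_field (tangent_bundle A) C \<zeta> (cinv C z))
      (coord_field (tangent_bundle A) C \<zeta>' (cinv C z)))" if C': "C \<in> tangent_bundle A" for C \<zeta> \<zeta>'
  proof -
    obtain c where c: "c \<in> A" and C: "C = TC c" using C' by (auto simp: tangent_bundle_def)
    let ?S = "cmap c ` cdom c \<times> (UNIV :: 'e set)"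
    let ?g = "\<lambda>f h z. g (cinv c (fst z)) (coord_field A c (f z) (cinv c (fst z))) (coord_field A c (h z) (cinv c (fst z)))"
    have "smooth_on ?S (\<lambda>z. ?g (\<lambda>z. fst \<zeta>) (vcoord c \<zeta>') z + ?g (vcoord c \<zeta>) (\<lambda>z. fst \<zeta>') z)"
      by (intro smooth_on_add open_cmap_Times c smooth_tensor02 g02 smooth_on_const smooth_vcoord)
    moreover have "?G (cinv C z) (coord_field (tangent_bundle A) C \<zeta> (cinv C z))
        (coord_field (tangent_bundle A) C \<zeta>' (cinv C z)) =
        ?g (\<lambda>z. fst \<zeta>) (vcoord c \<zeta>') z + ?g (vcoord c \<zeta>) (\<lambda>z. fst \<zeta>') z" if z: "z \<in> ?S" for z
    proof -
      note tb = coord_field_TB[OF c z]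
      show ?thesis
        unfolding C tb(2) unfolding tb(1)
        by (intro TM_metric_lift tb(4) coord_field_in c tb(3))
    qed
    ultimately show ?thesis
      unfolding C cmap_TC_cdom[OF c] by (subst smooth_on_cong[OF open_cmap_Times[OF c]]) auto
  qed
  have "tensor02 (tangent_bundle A) ?G"
    unfolding tensor02_def
  proof (intro conjI ballI allI smoothG)
    fix q w w' z r assume q: "q \<in> carrier (tangent_bundle A)"
      and wz: "w \<in> tangent_space (tangent_bundle A) q"
        "w' \<in> tangent_space (tangent_bundle A) q" "z \<in> tangent_space (tangent_bundle A) q"
    note lin = linG[OF q wz]
    show "?G q (w + w') z = ?G q w z + ?G q w' z" "?G q (r *\<^sub>R w) z = r * ?G q w z"
      using lin by auto
    show "?G q z (w + w') = ?G q z w + ?G q z w'"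
      using lin symG[OF q _ wz(3)] wz TB.tangent_space_closed(1)[OF wz(1,2)] by simp
    show "?G q z (r *\<^sub>R w) = r * ?G q z w"
      using lin[of r] symG[OF q _ wz(3)] wz(1) TB.tangent_space_closed(4)[OF wz(1)] by simp
  qed
  moreover have "w = 0" if "q \<in> carrier (tangent_bundle A)" "w \<in> tangent_space (tangent_bundle A) q"
    and 0: "\<forall>z\<in>tangent_space (tangent_bundle A) q. ?G q w z = 0" for q w
  proof -
    obtain p v where pv: "q = (p, v)" by fastforce
    note that' = that
    note q = that(1)[unfolded pv] and p = fibre(1)[OF that(1)[unfolded pv]]
    note z = zero_tangent[of p]
    obtain x y where w: "x \<in> tangent_space A p" "y \<in> tangent_space A p" "w = lift (p, v) x y"
      using lift_cases[OF q that'(2)[unfolded pv]] .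
    have g0: "g p u 0 = 0" if "u \<in> tangent_space A p" for u
      using tensor02D(4)[OF g02 p z that, of 0] by simp
    have "g p x u = 0" if u: "u \<in> tangent_space A p" for u
      using 0 lift_in[OF q z u] TM_metric_lift[OF q w(1,2) z u, of g] g0[OF w(2)] unfolding pv w(3) by simp
    then have "x = 0" by (rule nondeg[OF p w(1)])
    have "g p y u = 0" if u: "u \<in> tangent_space A p" for u
      using 0 lift_in[OF q u z] TM_metric_lift[OF q w(1,2) u z, of g] g0[OF w(1)] unfolding pv w(3) by simp
    then have "y = 0" by (rule nondeg[OF p w(2)])
    show ?thesis
      unfolding w(3) \<open>x = 0\<close> \<open>y = 0\<close> lift_def hlift_zero[OF q] vlift_zero[OF q] by simp
  qed
  ultimately show ?thesis
    unfolding pseudo_riemannian_metric_def using symG by blast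
qed

text \<open>A basis \<open>e\<close> of the base tangent space and half its dual basis \<open>f\<close> with respect to \<open>g\<close> give the
  hyperbolic pairs formed by the horizontal lifts of \<open>e\<close> and the vertical lifts of \<open>f\<close>.\<close>
lemma has_signature_TM_metric:
  assumes g: "pseudo_riemannian_metric A g" and q': "q \<in> carrier (tangent_bundle A)"
  shows "has_signature (tangent_space (tangent_bundle A) q) (TM_metric A nabla g q) DIM('e) DIM('e)"
proof -
  obtain p v where pv: "q = (p, v)" by fastforce
  note q = q'[unfolded pv] and p = fibre(1)[OF q'[unfolded pv]]
  obtain c where c: "c \<in> A" "p \<in> cdom c" using carrier_chart[OF p] .
  have g02: "tensor02 A g" using g unfolding pseudo_riemannian_metric_def by blast
  let ?e = "\<lambda>\<xi>. coord_field A c \<xi> p"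
  have e_in: "?e \<xi> \<in> tangent_space A p" for \<xi> using c by simp
  note e_lin = linear_add[OF linear_coord_field[OF c]] linear_cmul[OF linear_coord_field[OF c]]
  \<comment> \<open>lowering an index with \<open>g\<close>, in the coordinates of \<open>c\<close>\<close>
  define L where "L \<xi> = (\<Sum>b\<in>Basis. g p (?e \<xi>) (?e b) *\<^sub>R b)" for \<xi>
  have L: "linear L"
    by (rule linearI) (simp_all add: L_def e_lin tensor02D[OF g02 p e_in e_in] e_in
        scaleR_add_left sum.distrib scaleR_sum_right)
  have L_inner: "L \<xi> \<bullet> b = g p (?e \<xi>) (?e b)" if "b \<in> Basis" for \<xi> b
    using that by (simp add: L_def inner_sum_left inner_Basis if_distrib cong: if_cong)
  have "inj L"
    unfolding linear_injective_0[OF L]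
  proof (intro allI impI)
    fix \<xi> assume 0: "L \<xi> = 0"
    have lin: "linear (\<lambda>\<eta>. g p (?e \<xi>) (?e \<eta>))"
      by (rule linearI) (simp_all add: e_lin tensor02D[OF g02 p e_in e_in] e_in)
    have *: "g p (?e \<xi>) (?e \<eta>) = 0" for \<eta>
      unfolding linear_Basis_expansion[OF lin, of \<eta>]
      by (intro sum.neutral ballI) (simp add: L_inner[symmetric] 0)
    have "g p (?e \<xi>) y = 0" if "y \<in> tangent_space A p" for y
      using *[of "y c"] coord_field_self[OF that c] by simp
    then have "?e \<xi> = 0"
      using g p e_in unfolding pseudo_riemannian_metric_def by blast
    then show "\<xi> = 0" using coord_field_comp[OF c, of \<xi>] by simp
  qed
  then have "surj L" using linear_injective_imp_surjective[OF L] by simp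
  define \<phi> where "\<phi> b = inv L ((1 / 2) *\<^sub>R b)" for b
  have L\<phi>: "L (\<phi> b) = (1 / 2) *\<^sub>R b" for b
    unfolding \<phi>_def by (rule surj_f_inv_f[OF \<open>surj L\<close>])
  have expand: "\<eta> = (\<Sum>b\<in>Basis. (2 * (L \<eta> \<bullet> b)) *\<^sub>R \<phi> b)" for \<eta>
  proof (rule injD[OF \<open>inj L\<close>])
    show "L \<eta> = L (\<Sum>b\<in>Basis. (2 * (L \<eta> \<bullet> b)) *\<^sub>R \<phi> b)"
      by (simp add: linear_sum[OF L] linear_cmul[OF L] L\<phi> euclidean_representation)
  qed
  let ?V = "tangent_space (tangent_bundle A) (p, v)" and ?G = "TM_metric A nabla g (p, v)"
  note z = zero_tangent[of p]
  let ?h = "\<lambda>\<xi>. lift (p, v) (?e \<xi>) 0" and ?k = "\<lambda>\<xi>. lift (p, v) 0 (?e \<xi>)"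
  have h_lin: "linear ?h" and k_lin: "linear ?k"
    by (rule linearI; simp add: e_lin lift_add[OF q e_in z e_in z] lift_add[OF q z e_in z e_in]
        lift_scaleR[OF q e_in z] lift_scaleR[OF q z e_in])+
  have gV: "tensor02 (tangent_bundle A) (TM_metric A nabla g)"
    and symG: "\<And>w z. w \<in> ?V \<Longrightarrow> z \<in> ?V \<Longrightarrow> ?G w z = ?G z w"
    using pseudo_riemannian_TM_metric[OF g] q unfolding pseudo_riemannian_metric_def by blast+
  have g0: "g p u 0 = 0" "g p 0 u = 0" if "u \<in> tangent_space A p" for u
    using tensor02D(3,4)[OF g02 p z that, of 0] by simp_all
  have "has_signature ?V ?G (card (Basis :: 'e set)) (card (Basis :: 'e set))"
  proof (rule has_signature_hyperbolic[where h="?h" and k="\<lambda>b. ?k (\<phi> b)"])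
    show "finite (Basis :: 'e set)" by simp
    show "subspace ?V" by (rule TB.subspace_tangent_space)
    show "?G (x + y) z = ?G x z + ?G y z" if "x \<in> ?V" "y \<in> ?V" "z \<in> ?V" for x y z
      using tensor02D(1)[OF gV q] that by blast
    show "?G (r *\<^sub>R x) z = r * ?G x z" if "x \<in> ?V" "z \<in> ?V" for r x z
      using tensor02D(3)[OF gV q] that by blast
    show "?G x y = ?G y x" if "x \<in> ?V" "y \<in> ?V" for x y using symG that by blast
    show "?h b \<in> ?V" "?k (\<phi> b) \<in> ?V" for b
      using lift_in[OF q e_in z] lift_in[OF q z e_in] by auto
    show "?G (?h a) (?h b) = 0" "?G (?k (\<phi> a)) (?k (\<phi> b)) = 0" for a b
      by (simp_all add: TM_metric_lift[OF q e_in z e_in z] TM_metric_lift[OF q z e_in z e_in] g0 e_in z)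
    show "?G (?k (\<phi> a)) (?h b) = (if a = b then 1 / 2 else 0)" if "a \<in> Basis" "b \<in> Basis" for a b
      using that L_inner[OF that(2), of "\<phi> a"] unfolding L\<phi>
      by (cases "a = b") (simp_all add: TM_metric_lift[OF q z e_in e_in z] g0 z inner_Basis)
    show "?V \<subseteq> span (?h ` Basis \<union> (\<lambda>b. ?k (\<phi> b)) ` Basis)" (is "_ \<subseteq> span ?B")
    proof
      fix w assume "w \<in> ?V"
      then obtain x y where w: "x \<in> tangent_space A p" "y \<in> tangent_space A p" "w = lift (p, v) x y"
        by (rule lift_cases[OF q])
      have 1: "?h (x c) \<in> span ?B"
        by (subst linear_Basis_expansion[OF h_lin, of "x c"]) (intro span_sum span_scale span_base, auto)
      have 2: "?k (y c) \<in> span ?B"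
        by (subst expand[of "y c"], subst linear_sum[OF k_lin], subst linear_cmul[OF k_lin])
          (intro span_sum span_scale span_base, auto)
      have 3: "?h (x c) + ?k (y c) = w"
        unfolding coord_field_self[OF w(1) c] coord_field_self[OF w(2) c] w(3) lift_add[OF q w(1) z z w(2)] by simp
      show "w \<in> span ?B" using span_add[OF 1 2] unfolding 3 .
    qed
  qed
  then show ?thesis by (simp add: pv)
qed

end

theorem theorem11p6:
  fixes n :: nat
    and A :: "('a, 'e::euclidean_space) chart set"
    and J :: "'a \<Rightarrow> ('a, 'e) tvec \<Rightarrow> ('a, 'e) tvec"
    and g g' :: "'a \<Rightarrow> ('a, 'e) tvec \<Rightarrow> ('a, 'e) tvec \<Rightarrow> real"
    and nabla :: "('a \<Rightarrow> ('a, 'e) tvec) \<Rightarrow> ('a \<Rightarrow> ('a, 'e) tvec) \<Rightarrow> 'a \<Rightarrow> ('a, 'e) tvec"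
    and J1 J2 J3 :: "('a, 'e) tpoint \<Rightarrow> (('a, 'e) tpoint, 'e \<times> 'e) tvec \<Rightarrow> (('a, 'e) tpoint, 'e \<times> 'e) tvec"
    and G :: "('a, 'e) tpoint \<Rightarrow> (('a, 'e) tpoint, 'e \<times> 'e) tvec \<Rightarrow> (('a, 'e) tpoint, 'e \<times> 'e) tvec \<Rightarrow> real"
  assumes M: "almost_complex_norden_manifold n A J g g'"
    and nabla: "levi_civita_connection A g nabla"
    and J1: "J1 = TM_J1 A nabla J"
    and J2: "J2 = TM_J2 A nabla"
    and J3: "J3 = TM_J3 A nabla J"
    and G: "G = TM_metric A nabla g"
  shows
    "(\<forall>X Y. vector_field_on A (carrier A) X \<and> vector_field_on A (carrier A) Y \<longrightarrow>
      (\<forall>q\<in>carrier (tangent_bundle A).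
        (let JX = (\<lambda>p. J p (X p)); H = hor_lift A nabla; V = ver_lift A in
          J1 q (H X q) = - H JX q \<and> J1 q (V X q) = V JX q \<and>
          J2 q (H X q) = V X q \<and> J2 q (V X q) = - H X q \<and>
          J3 q (H X q) = V JX q \<and> J3 q (V X q) = H JX q \<and>
          G q (H X q) (H Y q) = 0 \<and> G q (V X q) (V Y q) = 0 \<and>
          G q (H X q) (V Y q) = g (fst q) (X (fst q)) (Y (fst q)) \<and>
          G q (V X q) (H Y q) = g (fst q) (X (fst q)) (Y (fst q)))))
    \<and> almost_hypercomplex_HN_manifold n (tangent_bundle A) J1 J2 J3 G
        (associated_tensor J1 G) (associated_tensor J2 G) (associated_tensor J3 G)"
proof -
  have sm: "smooth_manifold A" and dim: "DIM('e) = 2 * n"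
    and J: "tensor11 A J" and JJ: "\<And>p x. p \<in> carrier A \<Longrightarrow> x \<in> tangent_space A p \<Longrightarrow> J p (J p x) = - x"
    and g: "pseudo_riemannian_metric A g"
    and gJ: "\<And>p x y. p \<in> carrier A \<Longrightarrow> x \<in> tangent_space A p \<Longrightarrow> y \<in> tangent_space A p \<Longrightarrow>
      g p (J p x) (J p y) = - g p x y"
    using M unfolding almost_complex_norden_manifold_def almost_complex_structure_def by blast+
  interpret connection A nabla
    using sm nabla by unfold_locales (auto simp: smooth_manifold_def levi_civita_connection_def)
  have g02: "tensor02 A g" using g unfolding pseudo_riemannian_metric_def by blast
  have gneg: "g p (- x) y = - g p x y" "g p y (- x) = - g p y x"
    if "p \<in> carrier A" "x \<in> tangent_space A p" "y \<in> tangent_space A p" for p x y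
    using tensor02D(3,4)[OF g02 that, of "- 1"] by simp_all
  have Jneg: "J p (- x) = - J p x" if "p \<in> carrier A" "x \<in> tangent_space A p" for p x
    using tensor11D(3)[OF J that, of "- 1"] by simp
  note closed = tangent_space_closed(3)
  note lifts = TM_J1_lift[OF _ J] TM_J2_lift TM_J3_lift[OF _ J] TM_metric_lift
  \<comment> \<open>in terms of \<open>lift\<close>: \<open>J1\<close>, \<open>J2\<close>, \<open>J3\<close> send \<open>(x, y)\<close> to \<open>(- J x, J y)\<close>, \<open>(- y, x)\<close>, \<open>(J y, J x)\<close>\<close>
  have pointwise: "J1 q w = J2 q (J3 q w) \<and> J1 q w = - J3 q (J2 q w) \<and>
      J2 q w = J3 q (J1 q w) \<and> J2 q w = - J1 q (J3 q w) \<and>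
      J3 q w = J1 q (J2 q w) \<and> J3 q w = - J2 q (J1 q w) \<and>
      J1 q (J1 q w) = - w \<and> J2 q (J2 q w) = - w \<and> J3 q (J3 q w) = - w"
    if q: "q \<in> carrier (tangent_bundle A)" and w: "w \<in> tangent_space (tangent_bundle A) q" for q w
  proof -
    obtain p v where pv: "q = (p, v)" by fastforce
    note q = q[unfolded pv] and p = fibre(1)[OF q[unfolded pv]]
    obtain x y where xy: "x \<in> tangent_space A p" "y \<in> tangent_space A p" "w = lift (p, v) x y"
      using lift_cases[OF q w[unfolded pv]] .
    note Jxy = tensor11D(1)[OF J p xy(1)] tensor11D(1)[OF J p xy(2)]
    show ?thesis
      unfolding pv xy(3) J1 J2 J3
      by (simp add: lifts q closed xy(1,2) Jxy lift_uminus[OF q] Jneg[OF p] JJ[OF p])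
  qed
  have metric: "G q (J1 q w) (J1 q z) = G q w z \<and> G q (J2 q w) (J2 q z) = - G q w z \<and>
      G q (J3 q w) (J3 q z) = - G q w z"
    if q: "q \<in> carrier (tangent_bundle A)" and w: "w \<in> tangent_space (tangent_bundle A) q"
      and z: "z \<in> tangent_space (tangent_bundle A) q" for q w z
  proof -
    obtain p v where pv: "q = (p, v)" by fastforce
    note q = q[unfolded pv] and p = fibre(1)[OF q[unfolded pv]]
    obtain x y where xy: "x \<in> tangent_space A p" "y \<in> tangent_space A p" "w = lift (p, v) x y"
      using lift_cases[OF q w[unfolded pv]] .
    obtain x' y' where xy': "x' \<in> tangent_space A p" "y' \<in> tangent_space A p" "z = lift (p, v) x' y'"
      using lift_cases[OF q z[unfolded pv]] .
    note Jxy = tensor11D(1)[OF J p xy(1)] tensor11D(1)[OF J p xy(2)]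
      tensor11D(1)[OF J p xy'(1)] tensor11D(1)[OF J p xy'(2)]
    show ?thesis
      unfolding pv xy(3) xy'(3) J1 J2 J3 G
      by (simp add: lifts q closed xy(1,2) xy'(1,2) Jxy gneg[OF p] gJ[OF p])
  qed
  have "almost_complex_structure (tangent_bundle A) K" if "K \<in> {J1, J2, J3}" for K
    using tensor11_TM_J[OF J] pointwise that
    unfolding almost_complex_structure_def J1[symmetric] J2[symmetric] J3[symmetric] by blast
  moreover have "\<forall>(Ja, Jb, Jc)\<in>{(J1, J2, J3), (J2, J3, J1), (J3, J1, J2)}.
      \<forall>q\<in>carrier (tangent_bundle A). \<forall>w\<in>tangent_space (tangent_bundle A) q.
        Ja q w = Jb q (Jc q w) \<and> Ja q w = - Jc q (Jb q w)"
    unfolding ball_simps prod.case using pointwise by blast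
  moreover have "\<forall>(J, \<epsilon>)\<in>{(J1, 1), (J2, - 1), (J3, - 1)}.
      \<forall>q\<in>carrier (tangent_bundle A). \<forall>w\<in>tangent_space (tangent_bundle A) q.
        \<forall>z\<in>tangent_space (tangent_bundle A) q. G q (J q w) (J q z) = \<epsilon> * G q w z"
    unfolding ball_simps prod.case mult_1 mult_minus1 using metric by blast
  moreover have "DIM('e \<times> 'e) = 4 * n" using dim by simp
  moreover have "\<forall>q\<in>carrier (tangent_bundle A).
      has_signature (tangent_space (tangent_bundle A) q) (G q) (2 * n) (2 * n)"
    using has_signature_TM_metric[OF g] unfolding dim G by blast
  moreover have "pseudo_riemannian_metric (tangent_bundle A) G"
    unfolding G by (rule pseudo_riemannian_TM_metric[OF g])
  ultimately have "almost_hypercomplex_HN_manifold n (tangent_bundle A) J1 J2 J3 G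
        (associated_tensor J1 G) (associated_tensor J2 G) (associated_tensor J3 G)"
    unfolding almost_hypercomplex_HN_manifold_def
    using smooth_manifold_tangent_bundle[OF sm] by blast
  moreover have "let JX = (\<lambda>p. J p (X p)); H = hor_lift A nabla; V = ver_lift A in
          J1 q (H X q) = - H JX q \<and> J1 q (V X q) = V JX q \<and>
          J2 q (H X q) = V X q \<and> J2 q (V X q) = - H X q \<and>
          J3 q (H X q) = V JX q \<and> J3 q (V X q) = H JX q \<and>
          G q (H X q) (H Y q) = 0 \<and> G q (V X q) (V Y q) = 0 \<and>
          G q (H X q) (V Y q) = g (fst q) (X (fst q)) (Y (fst q)) \<and>
          G q (V X q) (H Y q) = g (fst q) (X (fst q)) (Y (fst q))"
    if X: "vector_field_on A (carrier A) X" and Y: "vector_field_on A (carrier A) Y"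
      and q: "q \<in> carrier (tangent_bundle A)" for X Y q
  proof -
    obtain p v where pv: "q = (p, v)" by fastforce
    note q = q[unfolded pv] and p = fibre(1)[OF q[unfolded pv]]
    have x: "X p \<in> tangent_space A p" and y: "Y p \<in> tangent_space A p"
      using X Y p by (auto simp: vector_field_on_def)
    note z = zero_tangent[of p]
    have J0: "J p 0 = 0" using tensor11D(3)[OF J p z, of 0] by simp
    have g0: "g p u 0 = 0" "g p 0 u = 0" if "u \<in> tangent_space A p" for u
      using tensor02D(3,4)[OF g02 p z that, of 0] by simp_all
    show ?thesis
      unfolding pv Let_def hor_lift_def ver_lift_def fst_conv hlift_eq_lift[OF q] vlift_eq_lift[OF q] J1 J2 J3 G
      by (simp add: lifts q x y z J0 g0 lift_uminus[OF q] tensor11D(1)[OF J p x])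
  qed
  ultimately show ?thesis by blast
qed


end
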